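(* For all integers $g$ and $k$, there exists a finite family of non-self-intersecting polygonal $3$-chains in the plane whose disjointness graph has girth at least $g$ and chromatic number at least $k$.
   Context: A polygonal $3$-chain is a continuous curve consisting of three straight-line segments $pq$, $qr$, $rs$ (consecutive segments sharing an endpoint). It is non-self-intersecting if it is a simple curve. The disjointness graph of a family of subsets of the plane has the members as vertices, two adjacent if and only if they are disjoint. The girth of a graph is the length of its shortest cycle (infinite if it has none). *)

theory Defs
  imports "HOL-Analysis.Analysis"
begin

definition chain3_path :: "real^2 \<Rightarrow> real^2 \<Rightarrow> real^2 \<Rightarrow> real^2 \<Rightarrow> real \<Rightarrow> real^2" where
  "chain3_path p q r s = linepath p q +++ (linepath q r +++ linepath r s)"

definition simple_3chain :: "(real^2) set \<Rightarrow> bool" where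
  "simple_3chain C \<longleftrightarrow> (\<exists>p q r s. arc (chain3_path p q r s) \<and> C = path_image (chain3_path p q r s))"

definition disj_adj :: "'a set set \<Rightarrow> 'a set \<Rightarrow> 'a set \<Rightarrow> bool" where
  "disj_adj F A B \<longleftrightarrow> A \<in> F \<and> B \<in> F \<and> A \<noteq> B \<and> A \<inter> B = {}"

definition is_cycle :: "'v set \<Rightarrow> ('v \<Rightarrow> 'v \<Rightarrow> bool) \<Rightarrow> 'v list \<Rightarrow> bool" where
  "is_cycle V E vs \<longleftrightarrow> length vs \<ge> 3 \<and> distinct vs \<and> set vs \<subseteq> V \<and>
     (\<forall>i < length vs. E (vs ! i) (vs ! ((i + 1) mod length vs)))"

text \<open>Girth: length of a shortest cycle (infinity if there is none).\<close>
definition girth :: "'v set \<Rightarrow> ('v \<Rightarrow> 'v \<Rightarrow> bool) \<Rightarrow> enat" where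
  "girth V E = (INF vs \<in> {vs. is_cycle V E vs}. enat (length vs))"

definition chromatic_number :: "'v set \<Rightarrow> ('v \<Rightarrow> 'v \<Rightarrow> bool) \<Rightarrow> nat" where
  "chromatic_number V E = (LEAST n. \<exists>c :: 'v \<Rightarrow> nat. (\<forall>v\<in>V. c v < n) \<and>
       (\<forall>u\<in>V. \<forall>v\<in>V. E u v \<longrightarrow> c u \<noteq> c v))"

end

theory Submission
  imports Defs "HOL-Library.Nat_Bijection"
begin

text \<open>
  A simple 3-chain consists of a nearly horizontal segment at height \<open>al\<close> ending at abscissa \<open>lo\<close>, a
  nearly vertical segment at abscissa \<open>hi\<close>, and a segment far away joining the other two ends, whose
  positions are ordered by \<open>ga\<close> and \<open>lo\<close>. Two segments of the same kind cross exactly when their ends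
  are ordered discordantly, and a horizontal one crosses a vertical one exactly when it is long
  enough. Hence two such chains are disjoint if and only if, in some order \<open>v\<close>, \<open>w\<close>, all four
  coordinates of \<open>v\<close> are smaller and \<open>lo w < hi v\<close>.

  This purely ordinal relation is rich enough to realise Tutte's construction of graphs with large
  girth and chromatic number: take a uniform hypergraph of large girth and chromatic number on an
  independent set, and match every hyperedge with its own copy of the previous graph. Since only the
  order of coordinates matters, an arbitrary hypergraph can be used, and it is obtained by partite
  amalgamation.
\<close>

text \<open>If \<open>below\<close> were transitive, the disjointness graph would be a comparability
  graph, hence perfect, and 2-colourable as soon as it has no triangle. So the overlap clause, which
  breaks transitivity, has to steer the construction. Tutte's construction leaves the matching
  between a copy and its hyperedge free; taking it increasing in \<open>lo\<close> works for every
  hyperedge, so the hypergraph only has to be sparse and of large chromatic number. Both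
  constructions rest on one gluing principle: \<open>Suc g\<close>-sparse pieces, hung on the edges
  of a \<open>g\<close>-sparse hypergraph so that no edge has two interface vertices, form a
  \<open>Suc g\<close>-sparse family. In the partite amalgamation the interface is one class, which
  a transversal edge meets at most once; in Tutte's step it is the independent set. The gain of one
  closes the induction on girth that produces the hypergraphs, and the leaf form of girth passes
  through the gluing without tracing cycles.\<close>

section \<open>Sparse hypergraphs\<close>

text \<open>High girth, phrased without cycles: every small subfamily has a leaf edge.\<close>

definition sparse :: "nat \<Rightarrow> 'a set set \<Rightarrow> bool" where
  "sparse g H \<longleftrightarrow> (\<forall>E\<subseteq>H. E \<noteq> {} \<longrightarrow> finite E \<longrightarrow> card E \<le> g \<longrightarrow>
     (\<exists>e\<in>E. \<exists>x. e \<inter> \<Union>(E - {e}) \<subseteq> {x}))"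

lemma sparseD:
  assumes "sparse g H" "E \<subseteq> H" "E \<noteq> {}" "finite E" "card E \<le> g"
  obtains e x where "e \<in> E" "e \<inter> \<Union>(E - {e}) \<subseteq> {x}"
proof -
  have "\<exists>e\<in>E. \<exists>x. e \<inter> \<Union>(E - {e}) \<subseteq> {x}"
    using assms(1) assms(2-5) unfolding sparse_def by simp
  then show thesis by (elim bexE exE that)
qed

text \<open>The extra point \<open>x\<close> stands for an attachment of the family to something
  outside. A leaf \<open>e\<close> fails only if \<open>x\<close> is a private vertex of
  \<open>e\<close>; the remaining edges, rooted at the attachment point \<open>u\<close> of
  \<open>e\<close>, then have a leaf, which meets \<open>e\<close> at most in \<open>u\<close> and
  misses \<open>x\<close>.\<close>

lemma sparse_rooted:
  assumes "sparse g H" "E \<subseteq> H" "E \<noteq> {}" "finite E" "card E \<le> g"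
  shows "\<exists>e\<in>E. \<exists>y. e \<inter> insert x (\<Union>(E - {e})) \<subseteq> {y}"
  using assms(2-)
proof (induction "card E" arbitrary: E x rule: less_induct)
  case less
  obtain e u where e: "e \<in> E" "e \<inter> \<Union>(E - {e}) \<subseteq> {u}"
    using sparseD[OF assms(1) less.prems] by blast
  show ?case
  proof (cases "x \<in> e \<and> x \<notin> \<Union>(E - {e}) \<and> E - {e} \<noteq> {}")
    case False
    then consider "E - {e} = {}" | "e \<inter> insert x (\<Union>(E - {e})) \<subseteq> e \<inter> \<Union>(E - {e})"
      by blast
    then show ?thesis
    proof cases
      case 1
      then have "e \<inter> insert x (\<Union>(E - {e})) \<subseteq> {x}" by auto
      then show ?thesis using e(1) by metis
    next
      case 2
      then show ?thesis using e by (meson subset_trans)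
    qed
  next
    case True
    have "card (E - {e}) < card E"
      using e(1) less.prems(3) by (meson card_Diff1_less)
    then obtain e' y where e': "e' \<in> E - {e}" "e' \<inter> insert u (\<Union>(E - {e} - {e'})) \<subseteq> {y}"
      using less.hyps[of "E - {e}" u] less.prems True by auto
    have "\<Union>(E - {e'}) \<subseteq> e \<union> \<Union>(E - {e} - {e'})"
      by blast
    moreover have "e' \<inter> e \<subseteq> {u}" "x \<notin> e'"
      using e e'(1) True by blast+
    ultimately have "e' \<inter> insert x (\<Union>(E - {e'})) \<subseteq> e' \<inter> insert u (\<Union>(E - {e} - {e'}))"
      by blast
    then show ?thesis using e' by (meson DiffD1 subset_trans)
  qed
qed

lemma sparse_mono: "sparse g H \<Longrightarrow> G \<subseteq> H \<Longrightarrow> sparse g G"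
  unfolding sparse_def by blast

lemma sparse_image:
  assumes "sparse g H" and inj: "inj_on h (\<Union>H)"
  shows "sparse g ((`) h ` H)"
  unfolding sparse_def
proof (intro allI impI)
  fix E assume E: "E \<subseteq> (`) h ` H" "E \<noteq> {}" "finite E" "card E \<le> g"
  then obtain D where D: "D \<subseteq> H" "E = (`) h ` D" "inj_on ((`) h) D"
    by (meson subset_image_inj)
  then have "finite D" "card D \<le> g" "D \<noteq> {}"
    using E finite_image_iff card_image by (blast, metis card_image, blast)
  then obtain e x where e: "e \<in> D" "e \<inter> \<Union>(D - {e}) \<subseteq> {x}"
    using sparseD[OF assms(1) D(1)] by metis
  have "h ` e \<inter> \<Union>(E - {h ` e}) \<subseteq> {h x}"
  proof
    fix z assume "z \<in> h ` e \<inter> \<Union>(E - {h ` e})"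
    then obtain Z where Z: "Z \<in> E" "Z \<noteq> h ` e" "z \<in> Z" and "z \<in> h ` e" by blast
    from Z(1) obtain e' where e': "e' \<in> D" "Z = h ` e'" unfolding D(2) by (rule imageE)
    obtain a where a: "a \<in> e" "z = h a" using \<open>z \<in> h ` e\<close> by (rule imageE)
    obtain b where b: "b \<in> e'" "z = h b" using Z(3) e'(2) by auto
    have "a = b"
      using inj_onD[OF inj, of a b] a b e(1) e'(1) D(1) by auto
    moreover have "e' \<noteq> e" using Z(2) e'(2) by auto
    ultimately show "z \<in> {h x}" using e a b e'(1) by auto
  qed
  then show "\<exists>e\<in>E. \<exists>x. e \<inter> \<Union>(E - {e}) \<subseteq> {x}"
    using e(1) unfolding D(2) by (metis imageI)
qed

text \<open>The pieces \<open>P f\<close> meet each other only inside their interfaces \<open>h ` f\<close>. Gluing gains one in the girth: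
  if all \<open>g + 1\<close> edges lie in different pieces, any of them is a leaf because it has at most one
  interface vertex.\<close>

lemma sparse_amalgam:
  assumes J: "sparse g J" and h: "inj h"
    and P: "\<And>f. f \<in> J \<Longrightarrow> sparse (Suc g) (P f)"
    and glue: "\<And>f f'. f \<in> J \<Longrightarrow> f' \<in> J \<Longrightarrow> f \<noteq> f' \<Longrightarrow> \<Union>(P f) \<inter> \<Union>(P f') \<subseteq> h ` f \<inter> h ` f'"
    and meet: "\<And>f e. f \<in> J \<Longrightarrow> e \<in> P f \<Longrightarrow> \<exists>x. e \<inter> h ` f \<subseteq> {x}"
  shows "sparse (Suc g) (\<Union>f\<in>J. P f)"
  unfolding sparse_def
proof (intro allI impI)
  fix E assume E: "E \<subseteq> (\<Union>f\<in>J. P f)" "E \<noteq> {}" "finite E" "card E \<le> Suc g"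
  then have "\<forall>e\<in>E. \<exists>f. f \<in> J \<and> e \<in> P f" by blast
  then obtain k where k: "\<And>e. e \<in> E \<Longrightarrow> k e \<in> J \<and> e \<in> P (k e)" by metis
  have sep: "e \<inter> e' \<subseteq> h ` (k e \<inter> k e')" if "e \<in> E" "e' \<in> E" "k e \<noteq> k e'" for e e'
    using glue[of "k e" "k e'"] k that unfolding image_Int[OF h] by blast
  show "\<exists>e\<in>E. \<exists>x. e \<inter> \<Union>(E - {e}) \<subseteq> {x}"
  proof (cases "card (k ` E) \<le> g")
    case False
    then have "inj_on k E"
      using E(3,4) by (metis card_image_le eq_card_imp_inj_on le_Suc_eq le_antisym le_trans not_less_eq_eq)
    obtain e where e: "e \<in> E" using E(2) by blast
    obtain x where x: "e \<inter> h ` k e \<subseteq> {x}" using meet k e by metis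
    have "e \<inter> \<Union>(E - {e}) \<subseteq> e \<inter> h ` k e"
    proof
      fix z assume z: "z \<in> e \<inter> \<Union>(E - {e})"
      then obtain e' where e': "e' \<in> E" "e' \<noteq> e" "z \<in> e'" by blast
      then have "k e \<noteq> k e'" using \<open>inj_on k E\<close> e by (metis inj_onD)
      then show "z \<in> e \<inter> h ` k e" using sep[OF e e'(1)] z e'(3) by blast
    qed
    then show ?thesis using e x by (meson subset_trans)
  next
    case True
    have kE: "k ` E \<subseteq> J" "k ` E \<noteq> {}" "finite (k ` E)" using k E by auto
    \<comment> \<open>Contracting each piece to its hyperedge leaves at most \<open>g\<close>
      hyperedges, so some \<open>f\<close> is attached to the others at one vertex \<open>y\<close>
      at most. A leaf of piece \<open>f\<close> rooted at \<open>h y\<close> is then a leaf of all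
      of \<open>E\<close>.\<close>
    obtain f y where f: "f \<in> k ` E" "f \<inter> \<Union>(k ` E - {f}) \<subseteq> {y}"
      by (rule sparseD[OF J kE True])
    let ?E = "{e\<in>E. k e = f}"
    have "?E \<subseteq> E" by blast
    then have "card ?E \<le> Suc g" using card_mono[OF E(3)] E(4) le_trans by blast
   moreover have "f \<in> J" "?E \<noteq> {}" "finite ?E" using kE f E(3) by auto
    moreover have "?E \<subseteq> P f" using k by blast
    ultimately have "\<exists>e\<in>?E. \<exists>z. e \<inter> insert (h y) (\<Union>(?E - {e})) \<subseteq> {z}"
      using sparse_rooted[OF P] by presburger
    then obtain e z where e: "e \<in> ?E" "e \<inter> insert (h y) (\<Union>(?E - {e})) \<subseteq> {z}"
      by blast
    have "e \<inter> e' \<subseteq> {h y}" if "e' \<in> E" "k e' \<noteq> f" for e'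
    proof -
      have "f \<inter> k e' \<subseteq> {y}" using f that by blast
      then show ?thesis using sep[of e e'] e(1) that by blast
    qed
    then have "e \<inter> \<Union>(E - {e}) \<subseteq> e \<inter> insert (h y) (\<Union>(?E - {e}))" by blast
    then show ?thesis using e by (metis (no_types, lifting) mem_Collect_eq subset_trans)
  qed
qed

text \<open>An edge \<open>{s v, v}\<close> is a leaf as soon as it occurs, because
  \<open>s v\<close> lies in no other edge.\<close>

lemma sparse_pendant:
  assumes P: "sparse g P" and s: "inj_on s V" "s ` V \<inter> \<Union>P = {}" "s ` V \<inter> V = {}"
  shows "sparse g (P \<union> (\<lambda>v. {s v, v}) ` V)"
  unfolding sparse_def
proof (intro allI impI)
  fix E assume E: "E \<subseteq> P \<union> (\<lambda>v. {s v, v}) ` V" "E \<noteq> {}" "finite E" "card E \<le> g"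
  show "\<exists>e\<in>E. \<exists>x. e \<inter> \<Union>(E - {e}) \<subseteq> {x}"
  proof (cases "E \<subseteq> P")
    case True
    then show ?thesis using sparseD[OF P True E(2-)] by metis
  next
    case False
    then obtain v where v: "v \<in> V" "{s v, v} \<in> E" using E by blast
    have "s v \<notin> e" if e': "e \<in> E - {{s v, v}}" for e
    proof
      assume e: "s v \<in> e"
      then have "e \<notin> P" using v(1) s(2) by blast
      then obtain w where "w \<in> V" "e = {s w, w}" using e' E(1) by blast
      then show False using e e' v(1) s(1,3) by (auto simp: inj_on_def)
    qed
    then have "{s v, v} \<inter> \<Union>(E - {{s v, v}}) \<subseteq> {v}" by blast
    then show ?thesis using v by metis
  qed
qed

section \<open>Sparse hypergraphs with large chromatic number\<close>

text \<open>The palette is an arbitrary set because Tutte's argument removes one colour and goes on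
  with the rest. Asking for \<open>y \<in> C\<close> has content only for an empty edge, which can
  occur: the amalgamation uses edges as large as a class, and a class may be empty.\<close>

definition ramsey :: "nat \<Rightarrow> 'a set set \<Rightarrow> bool" where
  "ramsey k H \<longleftrightarrow> (\<forall>(c :: 'a \<Rightarrow> nat) C. finite C \<longrightarrow> C \<noteq> {} \<longrightarrow> card C \<le> k \<longrightarrow> c ` \<Union>H \<subseteq> C \<longrightarrow>
     (\<exists>f\<in>H. \<exists>y\<in>C. \<forall>x\<in>f. c x = y))"

lemma ramseyD:
  fixes c :: "'a \<Rightarrow> nat"
  assumes "ramsey k H" "finite C" "C \<noteq> {}" "card C \<le> k" "c ` \<Union>H \<subseteq> C"
  obtains f y where "f \<in> H" "y \<in> C" "\<forall>x\<in>f. c x = y"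
proof -
  have "\<exists>f\<in>H. \<exists>y\<in>C. \<forall>x\<in>f. c x = y"
    using assms(1)[unfolded ramsey_def, rule_format, OF assms(2-5)] .
  then show thesis using that by auto
qed

lemma ramsey_image:
  assumes "ramsey k H"
  shows "ramsey k ((`) h ` H)"
  unfolding ramsey_def
proof (intro allI impI)
  fix c :: "'b \<Rightarrow> nat" and C
  assume C: "finite C" "C \<noteq> {}" "card C \<le> k" "c ` \<Union>((`) h ` H) \<subseteq> C"
  have "(c \<circ> h) ` \<Union>H \<subseteq> C" using C(4) by auto
  then obtain f y where "f \<in> H" "y \<in> C" "\<forall>x\<in>f. (c \<circ> h) x = y"
    by (rule ramseyD[OF assms C(1-3)])
  then show "\<exists>f\<in>(`) h ` H. \<exists>y\<in>C. \<forall>x\<in>f. c x = y" by auto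
qed

text \<open>Pigeonhole: classes with fewer than \<open>m\<close> points would cover at most
  \<open>k * m\<close> points. The surplus \<open>m\<close> spares any rounding and guarantees
  \<open>m\<close> points whatever \<open>k\<close> is.\<close>

lemma large_colour_class:
  assumes C: "finite C" "C \<noteq> {}" "card C \<le> k" and d: "d ` {..<m * k + m} \<subseteq> C"
  obtains D y where "D \<subseteq> {..<m * k + m}" "finite D" "card D = m" "y \<in> C" "\<And>j. j \<in> D \<Longrightarrow> d j = y"
proof -
  let ?A = "{..<m * k + m}"
  have "\<exists>y\<in>C. m \<le> card {j\<in>?A. d j = y}"
  proof (rule ccontr)
    assume "\<not> ?thesis"
    then have small: "\<And>y. y \<in> C \<Longrightarrow> card {j\<in>?A. d j = y} < m" by force
    have "?A = (\<Union>y\<in>C. {j\<in>?A. d j = y})" using d by auto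
    then have "card ?A \<le> (\<Sum>y\<in>C. card {j\<in>?A. d j = y})"
      using card_UN_le[OF C(1), of "\<lambda>y. {j\<in>?A. d j = y}"] by argo
    also have "\<dots> \<le> card C * m"
      using sum_bounded_above[of C "\<lambda>y. card {j\<in>?A. d j = y}" m] small by (simp add: less_imp_le)
    also have "\<dots> \<le> k * m" using C(3) by simp
    finally have "m = 0" by (simp add: mult.commute)
    then show False using small C(2) by auto
  qed
  then obtain y where y: "y \<in> C" "m \<le> card {j\<in>?A. d j = y}" by auto
  then obtain D where "D \<subseteq> {j\<in>?A. d j = y}" "card D = m" "finite D"
    by (meson obtain_subset_with_card_n)
  then show thesis using y(1) by (intro that[of D y]) auto
qed

text \<open>The partite amalgamation of Nesetril and Rodl. A vertex is a pair (class, name). At stage \<open>i\<close>,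
  every colouring that is constant on each of the classes \<open>i, i + 1, \<dots>\<close> has a monochromatic edge.
  The next stage glues copies along class \<open>i\<close>, following a hypergraph that is already available for
  girth one smaller.\<close>

definition partite_ramsey :: "nat \<Rightarrow> nat \<Rightarrow> nat \<Rightarrow> (nat \<times> nat) set set \<Rightarrow> bool" where
  "partite_ramsey k a i P \<longleftrightarrow> (\<forall>(c :: nat \<times> nat \<Rightarrow> nat) d C. finite C \<longrightarrow> C \<noteq> {} \<longrightarrow> card C \<le> k \<longrightarrow>
     c ` \<Union>P \<subseteq> C \<longrightarrow> d ` {..<a} \<subseteq> C \<longrightarrow> (\<forall>j x. (j, x) \<in> \<Union>P \<longrightarrow> i \<le> j \<longrightarrow> c (j, x) = d j) \<longrightarrow>
     (\<exists>e\<in>P. \<exists>y\<in>C. \<forall>x\<in>e. c x = y))"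

definition partite :: "nat \<Rightarrow> nat \<Rightarrow> (nat \<times> nat) set set \<Rightarrow> bool" where
  "partite m a P \<longleftrightarrow> finite P \<and> (\<forall>e\<in>P. finite e \<and> card e = m \<and> inj_on fst e \<and> fst ` e \<subseteq> {..<a})"

text \<open>There is one edge for each \<open>m\<close>-subset \<open>D\<close> of the classes;
  naming its vertices by \<open>D\<close> makes distinct edges disjoint. A colouring constant on the
  classes is a colouring of \<open>{..<a}\<close>, and pigeonhole finds \<open>D\<close>.\<close>

lemma partite_base:
  assumes a: "a = m * k + m"
  shows "\<exists>P. partite m a P \<and> sparse g P \<and> partite_ramsey k a 0 P"
proof -
  define edge where "edge D = (\<lambda>j. (j, set_encode D)) ` D" for D
  define P where "P = edge ` {D. D \<subseteq> {..<a} \<and> card D = m}"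
  have fin: "finite D" if "D \<subseteq> {..<a}" for D
    using that finite_subset by blast
  have "partite m a P"
    unfolding partite_def P_def edge_def
    by (auto simp: inj_on_def card_image fin)
  moreover have "sparse g P"
    unfolding sparse_def
  proof (intro allI impI)
    fix E assume E: "E \<subseteq> P" "E \<noteq> {}"
    then obtain e where e: "e \<in> E" by blast
    have "e \<inter> e' = {}" if e': "e' \<in> E" "e' \<noteq> e" for e'
    proof -
      obtain D where D: "D \<subseteq> {..<a}" "e = edge D" using E e unfolding P_def by blast
      obtain D' where D': "D' \<subseteq> {..<a}" "e' = edge D'" using E e'(1) unfolding P_def by blast
      have "set_encode D \<noteq> set_encode D'"
        using fin D D' e'(2) set_encode_inverse by metis
      then show ?thesis unfolding D D' edge_def by auto
    qed
    then have "e \<inter> \<Union>(E - {e}) \<subseteq> {undefined}" by auto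
    then show "\<exists>e\<in>E. \<exists>x. e \<inter> \<Union>(E - {e}) \<subseteq> {x}" using e by metis
  qed
  moreover have "partite_ramsey k a 0 P"
    unfolding partite_ramsey_def
  proof (intro allI impI)
    fix c :: "nat \<times> nat \<Rightarrow> nat" and d C
    assume C: "finite C" "C \<noteq> {}" "card C \<le> k" "d ` {..<a} \<subseteq> C"
      and c: "\<forall>j x. (j, x) \<in> \<Union>P \<longrightarrow> 0 \<le> j \<longrightarrow> c (j, x) = d j"
    obtain D y where D: "D \<subseteq> {..<a}" "card D = m" "y \<in> C" "\<And>j. j \<in> D \<Longrightarrow> d j = y"
      using large_colour_class[OF C[unfolded a]] unfolding a by metis
    then have "edge D \<in> P" unfolding P_def by blast
    moreover have "c x = y" if x: "x \<in> edge D" for x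
    proof -
      obtain j where j: "j \<in> D" "x = (j, set_encode D)" using x unfolding edge_def by auto
      then have "(j, set_encode D) \<in> \<Union>P" using \<open>edge D \<in> P\<close> x by blast
      then show ?thesis using c D(4) j by auto
    qed
    ultimately show "\<exists>e\<in>P. \<exists>y\<in>C. \<forall>x\<in>e. c x = y" using D(3) by metis
  qed
  ultimately show ?thesis by blast
qed

text \<open>Each \<open>f \<in> H\<close> gets a copy of \<open>P\<close> whose class
  \<open>i\<close> is identified with \<open>f\<close>, all other names being tagged by
  \<open>f\<close>. For a colouring constant on the classes beyond \<open>i\<close>,
  \<open>H\<close> supplies an \<open>f\<close> on which class \<open>i\<close> is constant too, and
  stage \<open>i\<close> applies to that copy.\<close>

lemma partite_step:
  assumes hyp: "\<And>n. \<exists>H :: nat set set. finite H \<and> (\<forall>f\<in>H. finite f \<and> card f = n) \<and> sparse g H \<and> ramsey k H"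
    and P: "partite m a P" "sparse (Suc g) P" "partite_ramsey k a i P"
  shows "\<exists>P. partite m a P \<and> sparse (Suc g) P \<and> partite_ramsey k a (Suc i) P"
proof -
  define X where "X = {x. (i, x) \<in> \<Union>P}"
  have "finite (\<Union>P)" using P(1) unfolding partite_def by blast
  then have "finite X"
    unfolding X_def by (rule finite_vimageI[of _ "Pair i", unfolded vimage_def]) (simp add: inj_on_def)
  obtain H :: "nat set set" where H: "finite H" "\<And>f. f \<in> H \<Longrightarrow> finite f"
      "\<And>f. f \<in> H \<Longrightarrow> card f = card X" "sparse g H" "ramsey k H"
    using hyp[of "card X"] by metis
  have "\<forall>f. \<exists>s. f \<in> H \<longrightarrow> bij_betw s X f"
    using H(2,3) \<open>finite X\<close> finite_same_card_bij by metis
  then obtain s where s: "\<And>f. f \<in> H \<Longrightarrow> bij_betw (s f) X f" by metis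
  define t where "t f = (\<lambda>(j, x). if j = i then (i, s f x) else (j, prod_encode (set_encode f, x)))" for f
  define Q where "Q f = (`) (t f) ` P" for f
  have fst_t: "fst (t f v) = fst v" for f v unfolding t_def by (auto split: prod.splits)
  have inj: "inj_on (t f) (\<Union>P)" if "f \<in> H" for f
  proof (rule inj_onI)
    fix v w assume vw: "v \<in> \<Union>P" "w \<in> \<Union>P" "t f v = t f w"
    obtain j x where v: "v = (j, x)" by (metis surj_pair)
    obtain x' where w: "w = (j, x')" using fst_t[of f v] fst_t[of f w] vw(3) v by (metis fst_conv surj_pair)
    show "v = w"
    proof (cases "j = i")
      case True
      then have "x \<in> X" "x' \<in> X" "s f x = s f x'" using vw v w unfolding X_def t_def by auto
      then have "x = x'" using s[OF that] by (meson bij_betw_imp_inj_on inj_onD)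
      then show ?thesis using v w by simp
    qed (use vw v w t_def in auto)
  qed
  have cls: "z \<in> Pair i ` f" if z: "f \<in> H" "z \<in> \<Union>(Q f)" "fst z = i" for f z
  proof -
    obtain v where v: "v \<in> \<Union>P" "z = t f v" using z(2) unfolding Q_def by auto
    then obtain x where x: "v = (i, x)" using fst_t z(3) by (metis prod.collapse)
    then have "x \<in> X" using v X_def by auto
    then have "s f x \<in> f" using s[OF z(1)] bij_betwE by blast
    then show ?thesis using v x unfolding t_def by auto
  qed
  have "sparse (Suc g) (\<Union>f\<in>H. Q f)"
  proof (rule sparse_amalgam[OF H(4), of "Pair i"])
    show "inj (Pair i :: nat \<Rightarrow> nat \<times> nat)" by (auto simp: inj_on_def)
    show "sparse (Suc g) (Q f)" if "f \<in> H" for f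
      unfolding Q_def by (rule sparse_image[OF P(2) inj[OF that]])
    show "\<Union>(Q f) \<inter> \<Union>(Q f') \<subseteq> Pair i ` f \<inter> Pair i ` f'" if "f \<in> H" "f' \<in> H" "f \<noteq> f'" for f f'
    proof
      fix z assume z: "z \<in> \<Union>(Q f) \<inter> \<Union>(Q f')"
      obtain v where v: "z = t f v" using z unfolding Q_def by blast
      obtain v' where v': "z = t f' v'" using z unfolding Q_def by blast
      have "set_encode f \<noteq> set_encode f'"
        using H(2) that set_encode_inverse by metis
      then have "fst z = i"
        using v v' fst_t[of f v] fst_t[of f' v'] unfolding t_def by (auto split: prod.splits if_splits)
      then show "z \<in> Pair i ` f \<inter> Pair i ` f'" using cls that z by blast
    qed
    show "\<exists>x. e \<inter> Pair i ` f \<subseteq> {x}" if "f \<in> H" and e: "e \<in> Q f" for f e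
    proof -
      obtain e0 where e0: "e0 \<in> P" "e = t f ` e0" using e unfolding Q_def by auto
      then have "inj_on fst e0" using P(1) unfolding partite_def by auto
      then have eq: "v = w" if "v \<in> e" "w \<in> e" "fst v = i" "fst w = i" for v w
      proof -
        obtain v0 w0 where "v0 \<in> e0" "w0 \<in> e0" "v = t f v0" "w = t f w0"
          using \<open>v \<in> e\<close> \<open>w \<in> e\<close> unfolding e0(2) by blast
        then show ?thesis
          using that(3,4) fst_t \<open>inj_on fst e0\<close> by (metis inj_onD)
      qed
      show ?thesis
      proof (cases "e \<inter> Pair i ` f = {}")
        case False
        then obtain v where "v \<in> e \<inter> Pair i ` f" by blast
        then have v: "v \<in> e" "fst v = i" by auto
        have "e \<inter> Pair i ` f \<subseteq> {v}"
        proof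
          fix w assume "w \<in> e \<inter> Pair i ` f"
          then have "w \<in> e" "fst w = i" by auto
          then show "w \<in> {v}" using eq v by blast
        qed
        then show ?thesis by blast
      qed simp
    qed
  qed
  moreover have "partite m a (\<Union>f\<in>H. Q f)"
  proof -
    have "finite e \<and> card e = m \<and> inj_on fst e \<and> fst ` e \<subseteq> {..<a}" if fe: "f \<in> H" "e \<in> Q f" for f e
    proof -
      obtain e0 where e0: "e0 \<in> P" "e = t f ` e0" using fe(2) unfolding Q_def by auto
      then have p: "finite e0" "card e0 = m" "inj_on fst e0" "fst ` e0 \<subseteq> {..<a}"
        using P(1) unfolding partite_def by auto
      moreover have "inj_on (t f) e0"
        using inj_on_subset[OF inj[OF fe(1)]] e0(1) by blast
      ultimately show ?thesis
        unfolding e0(2) using fst_t by (auto simp: card_image image_subset_iff inj_on_def)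
    qed
    then show ?thesis
      using H(1) P(1) unfolding partite_def by (auto simp: Q_def)
  qed
  moreover have "partite_ramsey k a (Suc i) (\<Union>f\<in>H. Q f)"
    unfolding partite_ramsey_def
  proof (intro allI impI)
    fix c :: "nat \<times> nat \<Rightarrow> nat" and d C
    assume C: "finite C" "C \<noteq> {}" "card C \<le> k" and cC: "c ` \<Union>(\<Union>f\<in>H. Q f) \<subseteq> C"
      and d: "d ` {..<a} \<subseteq> C"
      and c: "\<forall>j x. (j, x) \<in> \<Union>(\<Union>f\<in>H. Q f) \<longrightarrow> Suc i \<le> j \<longrightarrow> c (j, x) = d j"
    have Q_mem: "t f v \<in> \<Union>(\<Union>f\<in>H. Q f)" if "f \<in> H" "v \<in> \<Union>P" for f v
      using that unfolding Q_def by blast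
    have "(c \<circ> Pair i) ` \<Union>H \<subseteq> C"
    proof
      fix y assume "y \<in> (c \<circ> Pair i) ` \<Union>H"
      then obtain f x where f: "f \<in> H" "x \<in> f" "y = c (i, x)" by auto
      then obtain x0 where x0: "x0 \<in> X" "x = s f x0"
        using s[OF f(1)] by (metis bij_betw_imp_surj_on imageE)
      then have "t f (i, x0) = (i, x)" "(i, x0) \<in> \<Union>P" unfolding t_def X_def by auto
      then show "y \<in> C" using subsetD[OF cC imageI[OF Q_mem[OF f(1), of "(i, x0)"]]] f(3) by simp
    qed
    then obtain f y where f: "f \<in> H" "y \<in> C" "\<forall>x\<in>f. (c \<circ> Pair i) x = y"
      by (rule ramseyD[OF H(5) C])
    have "(c \<circ> t f) ` \<Union>P \<subseteq> C"
      using subsetD[OF cC imageI[OF Q_mem[OF f(1)]]] by (intro image_subsetI) (simp only: o_apply)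
    moreover have "(d(i := y)) ` {..<a} \<subseteq> C" using d f(2) by auto
    moreover have "(c \<circ> t f) (j, x) = (d(i := y)) j" if jx: "(j, x) \<in> \<Union>P" "i \<le> j" for j x
    proof (cases "j = i")
      case True
      then have "s f x \<in> f" using jx(1) s[OF f(1)] X_def bij_betwE by blast
      then show ?thesis using True f(3) by (simp add: t_def)
    next
      case False
      then have "t f (j, x) = (j, prod_encode (set_encode f, x))" by (simp add: t_def)
      then show ?thesis using Q_mem[OF f(1) jx(1)] c jx(2) False by auto
    qed
    ultimately have "\<exists>e\<in>P. \<exists>y\<in>C. \<forall>x\<in>e. (c \<circ> t f) x = y"
      using P(3)[unfolded partite_ramsey_def, rule_format, OF C, of "c \<circ> t f" "d(i := y)"] by blast
    then obtain e y where "e \<in> P" "y \<in> C" "\<forall>x\<in>t f ` e. c x = y" by auto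
    then show "\<exists>e\<in>(\<Union>f\<in>H. Q f). \<exists>y\<in>C. \<forall>x\<in>e. c x = y"
      using f(1) unfolding Q_def by blast
  qed
  ultimately show ?thesis by blast
qed

text \<open>The size \<open>m\<close> stays free in the induction: to obtain edges of size
  \<open>m\<close>, the step calls for edges as large as a whole class of the current
  hypergraph.\<close>

lemma sparse_ramsey_hypergraph:
  "\<exists>H :: nat set set. finite H \<and> (\<forall>f\<in>H. finite f \<and> card f = m) \<and> sparse g H \<and> ramsey k H"
proof (induction g arbitrary: m)
  case 0
  define H :: "nat set set" where "H = {D. D \<subseteq> {..<m * k + m} \<and> card D = m}"
  have "finite H" "\<forall>f\<in>H. finite f \<and> card f = m"
    unfolding H_def using finite_subset by auto
  moreover have "sparse 0 H" unfolding sparse_def by auto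
  moreover have "ramsey k H"
    unfolding ramsey_def
  proof (intro allI impI)
    fix c :: "nat \<Rightarrow> nat" and C
    assume C: "finite C" "C \<noteq> {}" "card C \<le> k" "c ` \<Union>H \<subseteq> C"
    \<comment> \<open>For \<open>m = 0\<close> the union of \<open>H\<close> is empty, and nothing
      is known about the values of \<open>c\<close>.\<close>
    have "c ` {..<m * k + m} \<subseteq> C \<or> m = 0"
    proof (cases "m = 0")
      case False
      have "\<Union>H = {..<m * k + m}"
      proof (intro equalityI subsetI)
        fix x assume x: "x \<in> {..<m * k + m}"
        have "m - 1 \<le> card ({..<m * k + m} - {x})" using x by simp
        then obtain D where "D \<subseteq> {..<m * k + m} - {x}" "card D = m - 1" "finite D"
          by (meson obtain_subset_with_card_n)
        then have "insert x D \<in> H" unfolding H_def using x False by (auto simp: card_insert_if)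
        then show "x \<in> \<Union>H" by blast
      qed (auto simp: H_def)
      then show ?thesis using C(4) by simp
    qed simp
    then show "\<exists>f\<in>H. \<exists>y\<in>C. \<forall>x\<in>f. c x = y"
    proof
      assume "m = 0"
      then have "{} \<in> H" unfolding H_def by auto
      then show ?thesis using C(2) by auto
    next
      assume "c ` {..<m * k + m} \<subseteq> C"
      then obtain D y where "D \<subseteq> {..<m * k + m}" "card D = m" "y \<in> C" "\<And>j. j \<in> D \<Longrightarrow> c j = y"
        using large_colour_class[OF C(1-3)] by metis
      moreover have "D \<in> H" unfolding H_def using calculation(1,2) by simp
      ultimately show ?thesis by metis
    qed
  qed
  ultimately show ?case by blast
next
  case (Suc g)
  note hyp = Suc.IH
  define a where "a = m * k + m"
  have "\<exists>P. partite m a P \<and> sparse (Suc g) P \<and> partite_ramsey k a i P" for i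
  proof (induction i)
    case 0
    show ?case by (rule partite_base[OF a_def])
  next
    case (Suc i)
    then show ?case using partite_step[OF hyp] by metis
  qed
  then obtain P where P: "partite m a P" "sparse (Suc g) P" "partite_ramsey k a a P" by metis
  have "ramsey k P"
    unfolding ramsey_def
  proof (intro allI impI)
    fix c :: "nat \<times> nat \<Rightarrow> nat" and C
    assume C: "finite C" "C \<noteq> {}" "card C \<le> k" "c ` \<Union>P \<subseteq> C"
    \<comment> \<open>All classes lie below \<open>a\<close>, so at stage \<open>a\<close> no class
      is required to be constant, and any constant map into \<open>C\<close> serves as
      \<open>d\<close>.\<close>
    obtain y where "y \<in> C" using C(2) by blast
    then have "(\<lambda>_. y) ` {..<a} \<subseteq> C" by auto
    moreover have "j < a" if "(j, x) \<in> \<Union>P" for j x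
      using that P(1) unfolding partite_def by fastforce
    ultimately show "\<exists>e\<in>P. \<exists>y\<in>C. \<forall>x\<in>e. c x = y"
      using P(3)[unfolded partite_ramsey_def, rule_format, OF C, of "\<lambda>_. y"] by (meson leD)
  qed
  define H where "H = (`) prod_encode ` P"
  have "finite H" "\<forall>f\<in>H. finite f \<and> card f = m"
    using P(1) unfolding partite_def H_def by (auto simp: card_image inj_prod_encode)
  moreover have "sparse (Suc g) H"
    unfolding H_def by (intro sparse_image P(2) inj_prod_encode)
  moreover have "ramsey k H"
    unfolding H_def by (intro ramsey_image \<open>ramsey k P\<close>)
  ultimately show ?case by blast
qed

section \<open>An ordinal form of Tutte's construction\<close>

datatype vert = Vert (al: nat) (ga: nat) (lo: nat) (hi: nat)

text \<open>A vertex carries an interval with endpoints \<open>lo\<close>, \<open>hi\<close> and two further coordinates. Each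
  coordinate only matters up to order. The condition \<open>lo w < hi v\<close>, that the two intervals
  overlap, is what keeps the relation from being transitive.\<close>

definition below :: "vert \<Rightarrow> vert \<Rightarrow> bool" where
  "below v w \<longleftrightarrow> al v < al w \<and> ga v < ga w \<and> lo v < lo w \<and> lo w < hi v \<and> hi v < hi w"

definition edges :: "vert set \<Rightarrow> vert set set" where
  "edges F = {{v, w} |v w. v \<in> F \<and> w \<in> F \<and> below v w}"

text \<open>Ties would leave crossings undecided; \<open>lo v < hi v\<close> keeps the two outer
  segments of a chain apart.\<close>

definition generic :: "vert set \<Rightarrow> bool" where
  "generic F \<longleftrightarrow> inj_on al F \<and> inj_on ga F \<and> inj_on lo F \<and> inj_on hi F \<and>
     (\<forall>v\<in>F. \<forall>w\<in>F. lo v \<noteq> hi w) \<and> (\<forall>v\<in>F. lo v < hi v)"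

definition uncolourable :: "nat \<Rightarrow> vert set \<Rightarrow> bool" where
  "uncolourable k F \<longleftrightarrow> (\<forall>(c :: vert \<Rightarrow> nat) C. finite C \<longrightarrow> card C \<le> k \<longrightarrow> c ` F \<subseteq> C \<longrightarrow>
     (\<exists>v\<in>F. \<exists>w\<in>F. below v w \<and> c v = c w))"

section \<open>Two-digit numbers and order-preserving labellings\<close>

lemma digit_less:
  fixes K :: nat
  assumes "r < K" "r' < K"
  shows "K * a + r < K * b + r' \<longleftrightarrow> a < b \<or> a = b \<and> r < r'"
proof -
  have *: "K * a + r < K * b + r'" if "a < b" "r < K" for a b r r'
  proof -
    have "K * a + r < K * Suc a" using that(2) by simp
    also have "\<dots> \<le> K * b" using that(1) by (intro mult_le_mono2) simp
    finally show ?thesis by simp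
  qed
  show ?thesis using *[of a b r r'] *[of b a r' r] assms by (cases a b rule: linorder_cases) auto
qed

lemma digit_eq:
  fixes K :: nat
  assumes "r < K" "r' < K"
  shows "K * a + r = K * b + r' \<longleftrightarrow> a = b \<and> r = r'"
  using digit_less[OF assms, of a b] digit_less[OF assms(2,1), of b a] by (metis nat_neq_iff)

text \<open>An element with \<open>n\<close> predecessors in the order of \<open>r\<close> goes to
  the member of \<open>f\<close> that has \<open>n\<close> smaller members.\<close>

lemma monotone_labelling:
  fixes r :: "'a \<Rightarrow> nat" and f :: "nat set"
  assumes "finite F" "finite f" "card f = card F"
  shows "\<exists>s. (\<forall>v\<in>F. s v \<in> f) \<and> (\<forall>v\<in>F. \<forall>w\<in>F. r v < r w \<longrightarrow> s v < s w)"
proof (intro exI conjI ballI impI)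
  let ?n = "\<lambda>v. card {w\<in>F. r w < r v}"
  let ?s = "\<lambda>v. enumerate f (?n v)"
  have n: "?n v < card f" if "v \<in> F" for v
    unfolding assms(3) using that by (intro psubset_card_mono assms(1)) auto
  show "?s v \<in> f" if "v \<in> F" for v
    using finite_enumerate_in_set[OF assms(2) n[OF that]] .
  show "?s v < ?s w" if "v \<in> F" "w \<in> F" "r v < r w" for v w
  proof (rule finite_enumerate_mono[OF _ assms(2) n[OF that(2)]])
    show "?n v < ?n w" using that assms(1) by (intro psubset_card_mono) auto
  qed
qed

section \<open>One step of Tutte's construction\<close>

locale tutte_step =
  fixes F :: "vert set" and H :: "nat set set" and s :: "nat set \<Rightarrow> vert \<Rightarrow> nat"
    and idx :: "nat set \<Rightarrow> nat" and M :: nat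
  assumes finF: "finite F" and genF: "generic F" and finH: "finite H"
    and idx: "inj_on idx H" "\<And>f. f \<in> H \<Longrightarrow> idx f < card H"
    and s: "\<And>f v. f \<in> H \<Longrightarrow> v \<in> F \<Longrightarrow> s f v \<in> f"
      "\<And>f v w. f \<in> H \<Longrightarrow> v \<in> F \<Longrightarrow> w \<in> F \<Longrightarrow> lo v < lo w \<Longrightarrow> s f v < s f w"
    and M: "\<And>v. v \<in> F \<Longrightarrow> al v < M \<and> ga v < M \<and> hi v < M" "\<And>i. i \<in> \<Union>H \<Longrightarrow> i < M"
begin

text \<open>Tutte's construction: one independent vertex \<open>S i\<close> for every point \<open>i\<close> of the hypergraph and one
  copy \<open>T f\<close> of \<open>F\<close> for every hyperedge \<open>f\<close>, with \<open>T f v\<close> joined to \<open>S (s f v)\<close>. Coordinates are written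
  in base \<open>K\<close>. In the first two, the leading digits of different copies are ordered oppositely, so
  that different copies are incomparable; in \<open>lo\<close> and \<open>hi\<close> the leading digit is a point of the
  hypergraph.\<close>

definition K where "K = M * card H + 2 * card H + M + 3"

text \<open>Since \<open>s f\<close> follows the order of \<open>lo\<close>, the value
  \<open>hi v\<close> cuts the copy at a point of the hypergraph. As a leading digit, this point
  records every comparison of \<open>hi v\<close> with a \<open>lo\<close> of the same copy.\<close>

definition top where "top f x = Max (s f ` {w\<in>F. lo w < x})"

text \<open>At each point of the hypergraph the low digits impose the order: \<open>lo\<close> of
  \<open>S\<close> (0), \<open>lo\<close> of the copies (1 to \<open>card H\<close>),
  \<open>hi\<close> of \<open>S\<close> (\<open>card H + 1\<close>), \<open>hi\<close> of the copies
  (from \<open>card H + 2\<close>). The interval of \<open>S i\<close> thus catches exactly the left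
  ends located at \<open>i\<close>. The summand \<open>card H * hi v + idx f\<close> breaks ties of
  \<open>top\<close> by the old \<open>hi\<close>, then by the copy.\<close>

definition T where
  "T f v = Vert (K * (idx f + 1) + al v) (K * (card H - idx f) + ga v) (K * s f v + (1 + idx f))
     (K * top f (hi v) + (card H + 2 + (card H * hi v + idx f)))"

definition S where "S i = Vert (K * 0 + i) (K * 0 + i) (K * i + 0) (K * i + (card H + 1))"

definition F' where "F' = S ` \<Union>H \<union> (\<Union>f\<in>H. T f ` F)"

text \<open>The low digit of \<open>hi\<close> stays below
  \<open>M * card H + 2 * card H + 2\<close>; the summand \<open>M\<close> of \<open>K\<close>
  accommodates \<open>al\<close>, \<open>ga\<close> and the points.\<close>

lemma digits:
  "f \<in> H \<Longrightarrow> 1 + idx f < K"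
  "f \<in> H \<Longrightarrow> v \<in> F \<Longrightarrow> card H + 2 + (card H * hi v + idx f) < K"
  "v \<in> F \<Longrightarrow> al v < K" "v \<in> F \<Longrightarrow> ga v < K" "i \<in> \<Union>H \<Longrightarrow> i < K" "card H + 1 < K" "0 < K"
proof -
  show "card H + 2 + (card H * hi v + idx f) < K" if "f \<in> H" "v \<in> F"
  proof -
    have "card H * hi v \<le> M * card H" using M(1)[OF that(2)] by (simp add: mult.commute)
    then show ?thesis using idx(2)[OF that(1)] unfolding K_def by linarith
  qed
qed (use idx(2) M in \<open>fastforce simp: K_def\<close>)+

lemma s_less: "f \<in> H \<Longrightarrow> v \<in> F \<Longrightarrow> w \<in> F \<Longrightarrow> s f v < s f w \<longleftrightarrow> lo v < lo w"
  by (metis s(2) nat_neq_iff genF[unfolded generic_def] inj_onD less_asym)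

lemma s_eq: "f \<in> H \<Longrightarrow> v \<in> F \<Longrightarrow> w \<in> F \<Longrightarrow> s f v = s f w \<longleftrightarrow> v = w"
  by (metis s(2) nat_neq_iff genF[unfolded generic_def] inj_onD)

lemma le_top:
  assumes "f \<in> H" "v \<in> F" "w \<in> F"
  shows "s f w \<le> top f (hi v) \<longleftrightarrow> lo w < hi v"
proof
  let ?A = "s f ` {w\<in>F. lo w < hi v}"
  have fin: "finite ?A" using finF by simp
  show "s f w \<le> top f (hi v)" if "lo w < hi v"
    unfolding top_def using fin that assms by (intro Max_ge) auto
  have "s f v \<in> ?A" using genF assms unfolding generic_def by blast
  then have "top f (hi v) \<in> ?A" unfolding top_def using Max_in[OF fin] by blast
  then obtain u where "u \<in> F" "lo u < hi v" "top f (hi v) = s f u" by auto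
  then show "lo w < hi v" if "s f w \<le> top f (hi v)"
    using that s_less[OF assms(1)] assms(3) by (metis less_trans not_le nat_neq_iff)
qed

lemma top_mono:
  assumes "f \<in> H" "v \<in> F" "hi v \<le> hi w"
  shows "top f (hi v) \<le> top f (hi w)"
  unfolding top_def
proof (rule Max_mono)
  have "v \<in> {w \<in> F. lo w < hi v}" using genF assms unfolding generic_def by blast
  then show "s f ` {w \<in> F. lo w < hi v} \<noteq> {}" by blast
qed (use assms finF in auto)

lemma T_less:
  assumes "f \<in> H" "f' \<in> H" "v \<in> F" "w \<in> F"
  shows "al (T f v) < al (T f' w) \<longleftrightarrow> idx f < idx f' \<or> idx f = idx f' \<and> al v < al w"
    "ga (T f v) < ga (T f' w) \<longleftrightarrow> idx f' < idx f \<or> idx f = idx f' \<and> ga v < ga w"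
    "lo (T f v) < lo (T f' w) \<longleftrightarrow> s f v < s f' w \<or> s f v = s f' w \<and> idx f < idx f'"
    "lo (T f' w) < hi (T f v) \<longleftrightarrow> s f' w \<le> top f (hi v)"
    "hi (T f v) < hi (T f' w) \<longleftrightarrow> top f (hi v) < top f' (hi w) \<or> top f (hi v) = top f' (hi w) \<and>
       (hi v < hi w \<or> hi v = hi w \<and> idx f < idx f')"
proof -
  note f = idx(2)[OF assms(1)] idx(2)[OF assms(2)]
  show "al (T f v) < al (T f' w) \<longleftrightarrow> idx f < idx f' \<or> idx f = idx f' \<and> al v < al w"
    unfolding T_def vert.sel digit_less[OF digits(3)[OF assms(3)] digits(3)[OF assms(4)]] by simp
  show "ga (T f v) < ga (T f' w) \<longleftrightarrow> idx f' < idx f \<or> idx f = idx f' \<and> ga v < ga w"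
    unfolding T_def vert.sel digit_less[OF digits(4)[OF assms(3)] digits(4)[OF assms(4)]]
    using f by auto
  show "lo (T f v) < lo (T f' w) \<longleftrightarrow> s f v < s f' w \<or> s f v = s f' w \<and> idx f < idx f'"
    unfolding T_def vert.sel digit_less[OF digits(1)[OF assms(1)] digits(1)[OF assms(2)]] by simp
  show "lo (T f' w) < hi (T f v) \<longleftrightarrow> s f' w \<le> top f (hi v)"
    unfolding T_def vert.sel digit_less[OF digits(1)[OF assms(2)] digits(2)[OF assms(1,3)]]
    using f by auto
  show "hi (T f v) < hi (T f' w) \<longleftrightarrow> top f (hi v) < top f' (hi w) \<or> top f (hi v) = top f' (hi w) \<and>
       (hi v < hi w \<or> hi v = hi w \<and> idx f < idx f')"
    unfolding T_def vert.sel digit_less[OF digits(2)[OF assms(1,3)] digits(2)[OF assms(2,4)]]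
      nat_add_left_cancel_less digit_less[OF f] ..
qed

lemma S_less:
  assumes "i \<in> \<Union>H" "f \<in> H" "v \<in> F"
  shows "al (S i) < al (T f v)" "ga (S i) < ga (T f v)"
    "lo (S i) < lo (T f v) \<longleftrightarrow> i \<le> s f v" "lo (T f v) < hi (S i) \<longleftrightarrow> s f v \<le> i"
    "hi (S i) < hi (T f v) \<longleftrightarrow> i \<le> top f (hi v)"
proof -
  note f = idx(2)[OF assms(2)]
  note d = digits(5)[OF assms(1)] digits(3,4)[OF assms(3)] digits(1)[OF assms(2)]
    digits(2)[OF assms(2,3)] digits(6,7)
  show "al (S i) < al (T f v)"
    unfolding S_def T_def vert.sel digit_less[OF d(1,2)] by simp
  show "ga (S i) < ga (T f v)"
    unfolding S_def T_def vert.sel digit_less[OF d(1,3)] using f by simp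
  show "lo (S i) < lo (T f v) \<longleftrightarrow> i \<le> s f v"
    unfolding S_def T_def vert.sel digit_less[OF d(7,4)] by auto
  show "lo (T f v) < hi (S i) \<longleftrightarrow> s f v \<le> i"
    unfolding S_def T_def vert.sel digit_less[OF d(4,6)] using f by auto
  show "hi (S i) < hi (T f v) \<longleftrightarrow> i \<le> top f (hi v)"
    unfolding S_def T_def vert.sel digit_less[OF d(6,5)] by auto
qed

lemma below_T:
  assumes "f \<in> H" "v \<in> F" "w \<in> F"
  shows "below (T f v) (T f w) \<longleftrightarrow> below v w"
proof -
  have "hi (T f v) < hi (T f w) \<longleftrightarrow> hi v < hi w"
    unfolding T_less(5)[OF assms(1,1,2,3)]
    using top_mono[OF assms(1,2), of w] top_mono[OF assms(1,3), of v]
    by (cases "hi v < hi w") (auto simp: not_less)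
  moreover have "lo (T f w) < hi (T f v) \<longleftrightarrow> lo w < hi v"
    unfolding T_less(4)[OF assms(1,1,2,3)] by (rule le_top[OF assms])
  ultimately show ?thesis
    unfolding below_def using T_less(1-3)[OF assms(1,1,2,3)] s_less[OF assms] by simp
qed

lemma not_below_T:
  assumes "f \<in> H" "f' \<in> H" "f \<noteq> f'" "v \<in> F" "w \<in> F"
  shows "\<not> below (T f v) (T f' w)"
proof -
  have "idx f \<noteq> idx f'" using inj_onD[OF idx(1)] assms(1-3) by blast
  then show ?thesis unfolding below_def T_less[OF assms(1,2,4,5)] by simp
qed

text \<open>The two overlap clauses say \<open>i \<le> s f v\<close> and
  \<open>s f v \<le> i\<close>; the clause on \<open>hi\<close> then holds because \<open>v\<close>
  itself competes in the maximum \<open>top\<close>.\<close>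

lemma below_S:
  assumes "f \<in> H" "v \<in> F" "i \<in> \<Union>H"
  shows "below (S i) (T f v) \<longleftrightarrow> s f v = i" "\<not> below (T f v) (S i)"
proof -
  have "s f v \<le> top f (hi v)"
    using le_top[OF assms(1,2,2)] genF assms(2) unfolding generic_def by blast
  then show "below (S i) (T f v) \<longleftrightarrow> s f v = i"
    unfolding below_def using S_less[OF assms(3,1,2)] by auto
  show "\<not> below (T f v) (S i)"
    unfolding below_def using S_less(1)[OF assms(3,1,2)] by simp
qed

text \<open>Distinct points carry disjoint intervals, so the overlap clause fails.\<close>

lemma not_below_S: "i \<in> \<Union>H \<Longrightarrow> j \<in> \<Union>H \<Longrightarrow> \<not> below (S i) (S j)"
  unfolding below_def S_def vert.sel using digit_less[OF digits(7,6)] digit_less[OF digits(7,7)]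
  by (metis leD nat_less_le)

lemma inj_S: "inj S"
  unfolding inj_on_def S_def by simp

lemma T_neq_S: "f \<in> H \<Longrightarrow> v \<in> F \<Longrightarrow> i \<in> \<Union>H \<Longrightarrow> T f v \<noteq> S i"
  using S_less(1) by (metis less_irrefl)

lemma T_eq:
  assumes "f \<in> H" "f' \<in> H" "v \<in> F" "w \<in> F" 
    and "al (T f v) = al (T f' w) \<or> ga (T f v) = ga (T f' w) \<or> lo (T f v) = lo (T f' w) \<or> hi (T f v) = hi (T f' w)"
  shows "f = f' \<and> v = w"
proof -
  have *: "idx f = idx f' \<and> (al v = al w \<or> ga v = ga w \<or> s f v = s f' w \<or> hi v = hi w)"
    using assms(5) T_less[OF assms(1,2,3,4)] T_less[OF assms(2,1,4,3)]
    by (metis nat_neq_iff)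
  then have f: "f = f'" using inj_onD[OF idx(1)] assms(1,2) by blast
  with * show ?thesis
    using s_eq[OF assms(2-4)] genF assms(3,4) unfolding generic_def inj_on_def by metis
qed

lemma F'_cases:
  assumes "x \<in> F'"
  obtains i where "i \<in> \<Union>H" "x = S i" | f v where "f \<in> H" "v \<in> F" "x = T f v"
  using assms unfolding F'_def by auto

lemma S_neq:
  assumes "i \<in> \<Union>H" "f \<in> H" "v \<in> F"
  shows "al (S i) \<noteq> al (T f v)" "ga (S i) \<noteq> ga (T f v)" "lo (S i) \<noteq> lo (T f v)" "hi (S i) \<noteq> hi (T f v)"
    "lo (S i) \<noteq> hi (T f v)" "lo (T f v) \<noteq> hi (S i)"
proof -
  note d = digits(1)[OF assms(2)] digits(2)[OF assms(2,3)] digits(6,7)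
  show "al (S i) \<noteq> al (T f v)" "ga (S i) \<noteq> ga (T f v)"
    using S_less(1,2)[OF assms] by simp_all
  show "lo (S i) \<noteq> lo (T f v)"
    unfolding S_def T_def vert.sel digit_eq[OF d(4,1)] by simp
  show "hi (S i) \<noteq> hi (T f v)"
    unfolding S_def T_def vert.sel digit_eq[OF d(3,2)] by simp
  show "lo (S i) \<noteq> hi (T f v)"
    unfolding S_def T_def vert.sel digit_eq[OF d(4,2)] by simp
  show "lo (T f v) \<noteq> hi (S i)"
    unfolding S_def T_def vert.sel digit_eq[OF d(1,3)] using idx(2)[OF assms(2)] by simp
qed

lemma lo_neq_hi_T:
  assumes "f \<in> H" "f' \<in> H" "v \<in> F" "w \<in> F"
  shows "lo (T f' w) \<noteq> hi (T f v)"
  unfolding T_def vert.sel digit_eq[OF digits(1)[OF assms(2)] digits(2)[OF assms(1,3)]]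
  using idx(2)[OF assms(2)] by auto

lemma generic_F': "generic F'"
proof -
  have *: "x = y" if x: "x \<in> F'" and y: "y \<in> F'"
    and eq: "al x = al y \<or> ga x = ga y \<or> lo x = lo y \<or> hi x = hi y" for x y
    using x
  proof (cases rule: F'_cases)
    case x: (1 i)
    show ?thesis using y
    proof (cases rule: F'_cases)
      case (1 j)
      then show ?thesis using eq digits(7) x(2) unfolding S_def by auto
    next
      case (2 f v)
      then show ?thesis using eq S_neq(1-4)[OF x(1) 2(1,2)] unfolding 2(3) x(2) by simp
    qed
  next
    case x: (2 f v)
    show ?thesis using y
    proof (cases rule: F'_cases)
      case (1 j)
      then show ?thesis using eq S_neq(1-4)[OF 1(1) x(1,2)] unfolding 1(2) x(3) by simp
    next
      case (2 f' w)
      then show ?thesis using T_eq[OF x(1) 2(1) x(2) 2(2)] eq unfolding 2(3) x(3) by simp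
    qed
  qed
  have "lo x \<noteq> hi y" if x: "x \<in> F'" and y: "y \<in> F'" for x y
    using x
  proof (cases rule: F'_cases)
    case x: (1 i)
    show ?thesis using y
    proof (cases rule: F'_cases)
      case (1 j)
      show ?thesis
        unfolding 1(2) x(2) S_def vert.sel digit_eq[OF digits(7,6)] by simp
    next
      case (2 f v)
      then show ?thesis using S_neq(5)[OF x(1) 2(1,2)] unfolding 2(3) x(2) by simp
    qed
  next
    case x: (2 f v)
    show ?thesis using y
    proof (cases rule: F'_cases)
      case (1 j)
      then show ?thesis using S_neq(6)[OF 1(1) x(1,2)] unfolding 1(2) x(3) by simp
    next
      case (2 f' w)
      then show ?thesis using lo_neq_hi_T[OF 2(1) x(1) 2(2) x(2)] unfolding 2(3) x(3) by simp
    qed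
  qed
  moreover have "lo x < hi x" if x: "x \<in> F'" for x
    using x
  proof (cases rule: F'_cases)
    case (1 i)
    show ?thesis unfolding 1 S_def by simp
  next
    case (2 f v)
    have "lo v < hi v" using genF 2(2) unfolding generic_def by blast
    then show ?thesis
      unfolding 2(3) T_less(4)[OF 2(1,1,2,2)] using le_top[OF 2(1,2,2)] by simp
  qed
  ultimately show ?thesis unfolding generic_def inj_on_def using * by simp
qed

text \<open>A piece is a copy of \<open>F\<close> with its matching edges, which are pendant. Pieces
  share only vertices of the independent set, and no edge has two of these, so amalgamation over
  \<open>H\<close> applies.\<close>

lemma sparse_F':
  assumes "sparse g H" "sparse (Suc g) (edges F)"
  shows "sparse (Suc g) (edges F')"
proof -
  \<comment> \<open>For \<open>x = T f v\<close> the quotient \<open>lo x div K\<close> is the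
    leading digit \<open>s f v\<close>, so \<open>S (lo x div K)\<close> is the partner of
    \<open>x\<close>.\<close>
  define P where "P f = (`) (T f) ` edges F \<union> (\<lambda>x. {S (lo x div K), x}) ` T f ` F" for f
  have lo_div: "lo (T f v) div K = s f v" if "f \<in> H" for f v
  proof -
    have "(K * a + r) div K = a" if "r < K" for a r :: nat using that by simp
    then show ?thesis unfolding T_def vert.sel using digits(1)[OF that] by metis
  qed
  have inj_T: "inj_on (T f) F" if "f \<in> H" for f
    using T_eq[OF that that] by (auto simp: inj_on_def)
  have edges_F: "\<Union>(edges F) \<subseteq> F" unfolding edges_def by blast
  have S_T: "S i \<notin> T f ` F" if "f \<in> H" "i \<in> \<Union>H" for f i
    using T_neq_S[OF that(1) _ that(2)] by force
  have T_S: "T f ` F \<inter> S ` f' = {}" if f: "f \<in> H" "f' \<in> H" for f f'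
  proof (rule equals0I)
    fix x assume "x \<in> T f ` F \<inter> S ` f'"
    then obtain i where "i \<in> f'" "S i \<in> T f ` F" by (metis Int_iff imageE)
    then show False using S_T[OF f(1), of i] f(2) by blast
  qed
  have P_sub: "\<Union>(P f) \<subseteq> S ` f \<union> T f ` F" if "f \<in> H" for f
    unfolding P_def using edges_F lo_div[OF that] s(1)[OF that] by (auto simp: image_iff)
  have "sparse (Suc g) (\<Union>f\<in>H. P f)"
  proof (rule sparse_amalgam[OF assms(1) inj_S])
    show "sparse (Suc g) (P f)" if f: "f \<in> H" for f
      unfolding P_def
    proof (rule sparse_pendant)
      show "sparse (Suc g) ((`) (T f) ` edges F)"
        by (rule sparse_image[OF assms(2) inj_on_subset[OF inj_T[OF f] edges_F]])
      show "inj_on (\<lambda>x. S (lo x div K)) (T f ` F)"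
        by (auto simp: inj_on_def inj_eq[OF inj_S] lo_div[OF f] s_eq[OF f])
      have "S (lo x div K) \<notin> T f ` F" if x: "x \<in> T f ` F" for x
      proof -
        obtain v where v: "v \<in> F" "lo x div K = s f v" using x lo_div[OF f] by auto
        have "s f v \<in> \<Union>H" using s(1)[OF f v(1)] f by blast
        then show ?thesis using S_T[OF f] v(2) by simp
      qed
      moreover have "\<Union>((`) (T f) ` edges F) \<subseteq> T f ` F" using edges_F by blast
      ultimately show "(\<lambda>x. S (lo x div K)) ` T f ` F \<inter> \<Union>((`) (T f) ` edges F) = {}"
        "(\<lambda>x. S (lo x div K)) ` T f ` F \<inter> T f ` F = {}" by blast+
    qed
    show "\<Union>(P f) \<inter> \<Union>(P f') \<subseteq> S ` f \<inter> S ` f'" if f: "f \<in> H" "f' \<in> H" "f \<noteq> f'" for f f'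
    proof -
      have "T f v \<noteq> T f' w" if "v \<in> F" "w \<in> F" for v w
        using T_eq[OF f(1,2) that] f(3) by metis
      then have "T f ` F \<inter> T f' ` F = {}" by blast
      then have "(S ` f \<union> T f ` F) \<inter> (S ` f' \<union> T f' ` F) \<subseteq> S ` f \<inter> S ` f'"
        using T_S[OF f(1,2)] T_S[OF f(2,1)] by auto
      then show ?thesis using P_sub[OF f(1)] P_sub[OF f(2)] by (meson Int_mono order_trans)
    qed
    show "\<exists>x. e \<inter> S ` f \<subseteq> {x}" if f: "f \<in> H" and e: "e \<in> P f" for f e
    proof -
      from e consider "e \<subseteq> T f ` F" | i x where "e = {S i, x}" "x \<in> T f ` F"
        unfolding P_def using edges_F by blast
      then show ?thesis
      proof cases
        case 1
        then have "e \<inter> S ` f = {}" using T_S[OF f f] by blast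
        then show ?thesis by simp
      next
        case 2
        then have "e \<inter> S ` f \<subseteq> {S i}" using T_S[OF f f] by blast
        then show ?thesis by blast
      qed
    qed
  qed
  moreover have "edges F' \<subseteq> (\<Union>f\<in>H. P f)"
  proof
    fix e assume "e \<in> edges F'"
    then obtain x y where xy: "x \<in> F'" "y \<in> F'" "below x y" "e = {x, y}"
      unfolding edges_def by blast
    have "\<exists>f\<in>H. e \<in> P f"
      using xy(2)
    proof (cases rule: F'_cases)
      case (1 i)
      show ?thesis using xy(1)
        by (cases rule: F'_cases) (use 1 xy(3) not_below_S below_S(2) in auto)
    next
      case y: (2 f w)
      show ?thesis using xy(1)
      proof (cases rule: F'_cases)
        case (1 i)
        then have "s f w = i" using below_S(1)[OF y(1,2) 1(1)] xy(3) y(3) by simp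
        then have "e = {S (lo y div K), y}" using lo_div[OF y(1)] 1 y xy(4) by simp
        then have "e \<in> P f" unfolding P_def using y by blast
        then show ?thesis using y(1) by blast
      next
        case (2 f' v)
        then have "f' = f" using not_below_T[OF 2(1) y(1) _ 2(2) y(2)] xy(3) y(3) by blast
        then have "below v w" using below_T[OF y(1) 2(2) y(2)] xy(3) y(3) 2(3) by simp
        then have "{v, w} \<in> edges F" unfolding edges_def using 2(2) y(2) by blast
        moreover have "e = T f ` {v, w}" using xy(4) 2(3) y(3) \<open>f' = f\<close> by simp
        ultimately have "e \<in> P f" unfolding P_def by blast
        then show ?thesis using y(1) by blast
      qed
    qed
    then show "e \<in> (\<Union>f\<in>H. P f)" by blast
  qed
  ultimately show ?thesis by (rule sparse_mono)
qed

text \<open>Some \<open>f\<close> is monochromatic on the independent set, of colour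
  \<open>y\<close>. A vertex of the copy of \<open>f\<close> with colour \<open>y\<close> clashes
  with its partner; if there is none, the copy uses at most \<open>k\<close> colours.\<close>

lemma uncolourable_F':
  assumes H: "ramsey (Suc k) H" "H \<noteq> {}" and F: "uncolourable k F" "F \<noteq> {}"
  shows "uncolourable (Suc k) F'"
  unfolding uncolourable_def
proof (intro allI impI)
  fix c :: "vert \<Rightarrow> nat" and C
  assume C: "finite C" "card C \<le> Suc k" "c ` F' \<subseteq> C"
  have mem: "S i \<in> F'" if "i \<in> \<Union>H" for i using that unfolding F'_def by blast
  have memT: "T f v \<in> F'" if "f \<in> H" "v \<in> F" for f v using that unfolding F'_def by blast
  have ne: "C \<noteq> {}" using H(2) F(2) memT C(3) by blast
  have "(c \<circ> S) ` \<Union>H \<subseteq> C" using C(3) mem by force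
  then obtain f y where f: "f \<in> H" "y \<in> C" "\<forall>i\<in>f. (c \<circ> S) i = y"
    by (rule ramseyD[OF H(1) C(1) ne C(2)])
  show "\<exists>v\<in>F'. \<exists>w\<in>F'. below v w \<and> c v = c w"
  proof (cases "\<exists>v\<in>F. c (T f v) = y")
    case True
    then obtain v where v: "v \<in> F" "c (T f v) = y" by blast
    have i: "s f v \<in> \<Union>H" "s f v \<in> f" using s(1)[OF f(1) v(1)] f(1) by auto
    then have "below (S (s f v)) (T f v)" "c (S (s f v)) = c (T f v)"
      using below_S(1)[OF f(1) v(1) i(1)] f(3) v(2) by auto
    then show ?thesis using mem[OF i(1)] memT[OF f(1) v(1)] by blast
  next
    case False
    have "(c \<circ> T f) ` F \<subseteq> C - {y}" using False C(3) memT[OF f(1)] by force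
    moreover have "finite (C - {y})" "card (C - {y}) \<le> k" using C f(2) by auto
    ultimately obtain v w where "v \<in> F" "w \<in> F" "below v w" "c (T f v) = c (T f w)"
      using F(1)[unfolded uncolourable_def, rule_format, of "C - {y}" "c \<circ> T f"] by auto
    then show ?thesis using below_T[OF f(1)] memT[OF f(1)] by blast
  qed
qed

lemma finite_F': "(\<And>f. f \<in> H \<Longrightarrow> finite f) \<Longrightarrow> finite F'"
  unfolding F'_def using finH finF by auto

end

text \<open>The base is a single vertex, which an empty palette cannot colour. The girth bound does
  not degrade as \<open>k\<close> grows.\<close>

lemma uncolourable_sparse:
  "\<exists>F. finite F \<and> F \<noteq> {} \<and> generic F \<and> sparse (Suc g) (edges F) \<and> uncolourable k F"
proof (induction k)
  case 0
  have "edges {Vert 0 0 0 1} = {}" unfolding edges_def below_def by auto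
  then show ?case
    by (intro exI[of _ "{Vert 0 0 0 1}"]) (auto simp: generic_def sparse_def uncolourable_def)
next
  case (Suc k)
  then obtain F where F: "finite F" "F \<noteq> {}" "generic F" "sparse (Suc g) (edges F)" "uncolourable k F"
    by blast
  obtain H :: "nat set set" where H: "finite H" "\<And>f. f \<in> H \<Longrightarrow> finite f"
      "\<And>f. f \<in> H \<Longrightarrow> card f = card F" "sparse g H" "ramsey (Suc k) H"
    using sparse_ramsey_hypergraph[of "card F" g "Suc k"] by metis
  have "H \<noteq> {}" using H(5)[unfolded ramsey_def, rule_format, of "{0}" "\<lambda>_. 0"] by auto
  have "\<forall>f. \<exists>s. f \<in> H \<longrightarrow> (\<forall>v\<in>F. s v \<in> f) \<and> (\<forall>v\<in>F. \<forall>w\<in>F. lo v < lo w \<longrightarrow> s v < s w)"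
    using monotone_labelling[OF F(1) H(2,3), of _ lo] by blast
  then obtain s where s: "\<And>f. f \<in> H \<Longrightarrow> (\<forall>v\<in>F. s f v \<in> f) \<and> (\<forall>v\<in>F. \<forall>w\<in>F. lo v < lo w \<longrightarrow> s f v < s f w)"
    by metis
  obtain idx where "bij_betw idx H {0..<card H}"
    using ex_bij_betw_finite_nat[OF H(1)] by blast
  then have idx: "inj_on idx H" "\<And>f. f \<in> H \<Longrightarrow> idx f < card H"
    unfolding bij_betw_def by auto
  let ?N = "al ` F \<union> ga ` F \<union> hi ` F \<union> \<Union>H"
  have "finite ?N" using F(1) H(1,2) by auto
  then obtain M where "\<forall>n\<in>?N. n < M" using finite_nat_set_iff_bounded by metis
  then interpret tutte_step F H s idx M
    using F H idx s by unfold_locales auto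
  have "F' \<noteq> {}" using F(2) \<open>H \<noteq> {}\<close> unfolding F'_def by blast
  then show ?case
    using finite_F'[OF H(2)] generic_F' sparse_F'[OF H(4) F(4)] uncolourable_F'[OF H(5) \<open>H \<noteq> {}\<close> F(5,2)]
    by blast
qed

section \<open>Nearly horizontal and vertical segments\<close>

definition pt :: "real \<Rightarrow> real \<Rightarrow> real^2" where "pt x y = vector [x, y]"

lemma pt_nth [simp]: "pt x y $ 1 = x" "pt x y $ 2 = y"
  unfolding pt_def by simp_all

lemma pt_eq_iff: "z = pt x y \<longleftrightarrow> z $ 1 = x \<and> z $ 2 = y"
  by (auto simp: vec_eq_iff forall_2)

lemma in_segment_pt:
  "z \<in> closed_segment (pt x y) (pt x' y') \<longleftrightarrow>
     (\<exists>u. 0 \<le> u \<and> u \<le> 1 \<and> z $ 1 = (1 - u) * x + u * x' \<and> z $ 2 = (1 - u) * y + u * y')"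
  unfolding closed_segment_def by (auto simp: vec_eq_iff forall_2)

lemma segment_graph:
  fixes x :: real
  assumes "x1 < x2"
  shows "(\<exists>u. 0 \<le> u \<and> u \<le> 1 \<and> x = (1 - u) * x1 + u * x2 \<and> y = (1 - u) * y1 + u * y2) \<longleftrightarrow>
     x1 \<le> x \<and> x \<le> x2 \<and> y = y2 + (y2 - y1) / (x2 - x1) * (x - x2)"
proof
  assume "\<exists>u. 0 \<le> u \<and> u \<le> 1 \<and> x = (1 - u) * x1 + u * x2 \<and> y = (1 - u) * y1 + u * y2"
  then obtain u where u: "0 \<le> u" "u \<le> 1" "x = (1 - u) * x1 + u * x2" "y = (1 - u) * y1 + u * y2"
    by blast
  have "x = x1 + u * (x2 - x1)" "x = x2 - (1 - u) * (x2 - x1)" using u(3) by (simp_all add: algebra_simps)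
  moreover then have "x - x2 = (u - 1) * (x2 - x1)" by (simp add: algebra_simps)
  then have "(y2 - y1) / (x2 - x1) * (x - x2) = (y2 - y1) * (u - 1)" using assms by simp
  then have "y = y2 + (y2 - y1) / (x2 - x1) * (x - x2)" using u(4) by (simp add: algebra_simps)
  moreover have "0 \<le> u * (x2 - x1)" "0 \<le> (1 - u) * (x2 - x1)" using u assms by simp_all
  ultimately show "x1 \<le> x \<and> x \<le> x2 \<and> y = y2 + (y2 - y1) / (x2 - x1) * (x - x2)" by linarith
next
  assume r: "x1 \<le> x \<and> x \<le> x2 \<and> y = y2 + (y2 - y1) / (x2 - x1) * (x - x2)"
  define u where "u = (x - x1) / (x2 - x1)"
  have "x - x1 = u * (x2 - x1)" using assms unfolding u_def by simp
  then have x: "x = (1 - u) * x1 + u * x2" by (simp add: algebra_simps)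
  then have "x - x2 = (u - 1) * (x2 - x1)" by (simp add: algebra_simps)
  then have "(y2 - y1) / (x2 - x1) * (x - x2) = (y2 - y1) * (u - 1)" using assms by simp
  then have "y = (1 - u) * y1 + u * y2" using r by (simp add: algebra_simps)
  moreover have "0 \<le> u" "u \<le> 1" using r assms unfolding u_def by simp_all
  ultimately show "\<exists>u. 0 \<le> u \<and> u \<le> 1 \<and> x = (1 - u) * x1 + u * x2 \<and> y = (1 - u) * y1 + u * y2"
    using x by blast
qed

text \<open>In coordinates along the sides of a cone, the segments join \<open>(0, g)\<close> to \<open>(d, 0)\<close> and \<open>(0, g')\<close> to
  \<open>(d', 0)\<close>.\<close>

lemma cone_segments_meet:
  fixes d d' g g' :: real
  assumes pos: "0 < d" "0 < d'" "0 < g" "0 < g'" and ne: "d \<noteq> d'" "g \<noteq> g'"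
  shows "(\<exists>u u'. 0 \<le> u \<and> u \<le> 1 \<and> 0 \<le> u' \<and> u' \<le> 1 \<and> u * d = u' * d' \<and> (1 - u) * g = (1 - u') * g') \<longleftrightarrow>
     (d < d' \<longleftrightarrow> g' < g)"
proof
  assume "\<exists>u u'. 0 \<le> u \<and> u \<le> 1 \<and> 0 \<le> u' \<and> u' \<le> 1 \<and> u * d = u' * d' \<and> (1 - u) * g = (1 - u') * g'"
  then obtain u u' where u: "0 \<le> u" "u \<le> 1" "0 \<le> u'" "u' \<le> 1" and
    eq: "u * d = u' * d'" "(1 - u) * g = (1 - u') * g'" by blast
  \<comment> \<open>If \<open>u < u'\<close> the first equation fails, if \<open>u > u'\<close> the
    second; equality forces \<open>u = 0\<close> and then \<open>g = g'\<close>.\<close>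
  have *: False if "d < d'" "g < g'" "0 < d" "0 < g" "0 \<le> u" "u \<le> 1" "0 \<le> u'" "u' \<le> 1" 
    "u * d = u' * d'" "(1 - u) * g = (1 - u') * g'" for u u' d d' g g' :: real
  proof (cases u u' rule: linorder_cases)
    case less
    then have "u * d < u' * d'"
      using that by (smt (verit) mult_strict_mono mult_le_less_imp_less)
    then show False using that(9) by simp
  next
    case greater
    then have "(1 - u) * g < (1 - u') * g'"
      using that by (smt (verit) mult_strict_mono mult_le_less_imp_less)
    then show False using that(10) by simp
  next
    case equal
    then show False using that(1,2,9,10) by auto
  qed
  have 1: "\<not> g < g'" if "d < d'"
    using *[OF that _ pos(1,3) u eq] by blast
  have 2: "\<not> g' < g" if "d' < d"
    using *[OF that _ pos(2,4) u(3,4,1,2) eq[symmetric]] by blast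
  show "d < d' \<longleftrightarrow> g' < g"
    using 1 2 ne by (cases "d < d'") (auto simp: not_less)
next
  assume "d < d' \<longleftrightarrow> g' < g"
  have *: "\<exists>u u'. 0 \<le> u \<and> u \<le> 1 \<and> 0 \<le> u' \<and> u' \<le> 1 \<and> u * d = u' * d' \<and> (1 - u) * g = (1 - u') * g'"
    if "d < d'" "g' < g" "0 < d" "0 < g'" for d d' g g' :: real
  proof -
    have den: "0 < g * d' - g' * d"
      using mult_strict_mono[of d d' g' g] that by (simp add: mult.commute)
    \<comment> \<open>Cramer's rule for the two equations, linear in \<open>u\<close> and
      \<open>u'\<close>, with determinant \<open>g * d' - g' * d\<close>.\<close>
    define u where "u = (g - g') * d' / (g * d' - g' * d)"
    define u' where "u' = (g - g') * d / (g * d' - g' * d)"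
    have "0 \<le> u" "0 \<le> u'" unfolding u_def u'_def using den that by simp_all
    moreover have "g' * d \<le> g' * d'" "g' * d \<le> g * d" using that by simp_all
    then have "u \<le> 1" "u' \<le> 1"
      unfolding u_def u'_def using den mult_strict_left_mono[OF that(1), of g] that
      by (simp_all add: algebra_simps)
    moreover have "u * d = u' * d'" unfolding u_def u'_def by simp
    moreover have "(1 - u) * g = (1 - u') * g'"
    proof -
      have "1 - u = g' * (d' - d) / (g * d' - g' * d)" "1 - u' = g * (d' - d) / (g * d' - g' * d)"
        unfolding u_def u'_def using den by (simp_all add: field_simps)
      then show ?thesis by simp
    qed
    ultimately show ?thesis by blast
  qed
  show "\<exists>u u'. 0 \<le> u \<and> u \<le> 1 \<and> 0 \<le> u' \<and> u' \<le> 1 \<and> u * d = u' * d' \<and> (1 - u) * g = (1 - u') * g'"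
  proof (cases "d < d'")
    case True
    then show ?thesis using * \<open>d < d' \<longleftrightarrow> g' < g\<close> pos by blast
  next
    case False
    then have "d' < d" "g < g'" using \<open>d < d' \<longleftrightarrow> g' < g\<close> ne by auto
    from *[OF this pos(2,3)] obtain u u' where "0 \<le> u" "u \<le> 1" "0 \<le> u'" "u' \<le> 1"
      "u * d' = u' * d" "(1 - u) * g' = (1 - u') * g" by blast
    then show ?thesis by (intro exI[of _ u'] exI[of _ u]) simp
  qed
qed

locale frame =
  fixes N :: real
  assumes N: "1 \<le> N"
begin

text \<open>\<open>line g a e\<close> joins \<open>(- D - 2 * g, g)\<close> to \<open>(e, a)\<close>. All parameters lie in \<open>[0, N]\<close>, so that \<open>D\<close> makes
  it nearly constant over \<open>[0, N]\<close>.\<close>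

definition D where "D = 8 * N\<^sup>2"

definition slope where "slope g a e = (a - g) / (e + D + 2 * g)"

definition line where "line g a e x = a + slope g a e * (x - e)"

lemma D_ge: "8 * N \<le> D" "8 \<le> D"
proof -
  have "N * 1 \<le> N * N" using N by (intro mult_left_mono) auto
  then show "8 * N \<le> D" unfolding D_def power2_eq_square by simp
  then show "8 \<le> D" using N by simp
qed

text \<open>This fixes the 8 in \<open>D\<close>: numerator at most \<open>N\<close>, denominator at
  least \<open>8 * N\<^sup>2\<close>. The resulting errors, 1/8 over \<open>[0, N]\<close> and 1/4
  at the far end, are small against the gap 1 between distinct integer parameters.\<close>

lemma slope_bound:
  assumes "0 \<le> a" "a \<le> N" "0 \<le> g" "g \<le> N" "0 \<le> e"
  shows "\<bar>slope g a e\<bar> * N \<le> 1 / 8"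
proof -
  have "\<bar>a - g\<bar> * N \<le> N * N" using assms N by (intro mult_right_mono) auto
  also have "\<dots> = 1 / 8 * D" unfolding D_def power2_eq_square by simp
  also have "\<dots> \<le> 1 / 8 * (e + D + 2 * g)" using assms by (intro mult_left_mono) auto
  finally have "\<bar>a - g\<bar> * N / (e + D + 2 * g) \<le> 1 / 8"
    using assms D_ge by (simp add: pos_divide_le_eq)
  then show ?thesis unfolding slope_def using assms D_ge by (simp add: abs_divide)
qed

lemma line_near:
  assumes "0 \<le> a" "a \<le> N" "0 \<le> g" "g \<le> N" "0 \<le> e" "e \<le> N" "0 \<le> x" "x \<le> N"
  shows "\<bar>line g a e x - a\<bar> \<le> 1 / 8"
proof -
  have "\<bar>slope g a e * (x - e)\<bar> \<le> \<bar>slope g a e\<bar> * N"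
    unfolding abs_mult using assms by (intro mult_left_mono) auto
  then show ?thesis unfolding line_def using slope_bound[OF assms(1-5)] by simp
qed

lemma line_far:
  assumes "0 \<le> a" "a \<le> N" "0 \<le> g" "g \<le> N" "0 \<le> e" "0 \<le> g'" "g' \<le> N"
  shows "\<bar>line g a e (- D - 2 * g') - g\<bar> \<le> 1 / 4"
proof -
  have "slope g a e * (e + D + 2 * g) = a - g"
    unfolding slope_def using assms D_ge by simp
  then have "line g a e (- D - 2 * g') - g = slope g a e * (2 * (g - g'))"
    unfolding line_def by (simp add: algebra_simps)
  moreover have "\<bar>slope g a e * (2 * (g - g'))\<bar> \<le> \<bar>slope g a e\<bar> * (2 * N)"
    unfolding abs_mult[of "slope g a e"] using assms by (intro mult_left_mono) auto
  ultimately show ?thesis using slope_bound[OF assms(1-5)] by simp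
qed

lemma line_range:
  assumes "0 \<le> a" "a \<le> N" "0 \<le> g" "g \<le> N" "0 \<le> e" "- D - 2 * g \<le> x" "x \<le> e"
  shows "0 \<le> line g a e x" "line g a e x \<le> N"
proof -
  have "- D - 2 * g < e" using assms D_ge by simp
  then obtain u where u: "0 \<le> u" "u \<le> 1" "line g a e x = (1 - u) * g + u * a"
    using segment_graph[of "- D - 2 * g" e x "line g a e x" g a] assms(6,7)
    unfolding line_def slope_def by (auto simp: add.assoc)
  show "0 \<le> line g a e x" unfolding u(3) using u assms by simp
  have "(1 - u) * g + u * a \<le> (1 - u) * N + u * N" using u assms by (intro add_mono mult_left_mono) auto
  then show "line g a e x \<le> N" unfolding u(3) by (simp add: algebra_simps)
qed

lemma affine_pos:
  fixes A B x l r :: real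
  assumes "0 < A + B * l" "0 < A + B * r" "l \<le> x" "x \<le> r"
  shows "0 < A + B * x"
proof (cases "0 \<le> B")
  case True
  then have "B * l \<le> B * x" using assms(3) by (intro mult_left_mono)
  then show ?thesis using assms(1) by simp
next
  case False
  then have "B * r \<le> B * x" using assms(4) by (intro mult_left_mono_neg) auto
  then show ?thesis using assms(2) by simp
qed

lemma line_continuous [continuous_intros]:
  "continuous_on X f \<Longrightarrow> continuous_on X (\<lambda>x. line g a e (f x))"
  unfolding line_def by (intro continuous_intros)

text \<open>The difference of the lines is affine. At \<open>- D - 2 * g\<close> it has the sign of
  \<open>g' - g\<close>, over \<open>[0, N]\<close> that of \<open>a' - a\<close>. Equal signs
  exclude a zero between; opposite signs give one left of 0, where both segments are
  present.\<close>

lemma lines_meet: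
  assumes b: "0 \<le> a" "a \<le> N" "0 \<le> g" "g \<le> N" "0 \<le> e" "e \<le> N"
      "0 \<le> a'" "a' \<le> N" "0 \<le> g'" "g' \<le> N" "0 \<le> e'" "e' \<le> N"
    and g: "g + 1 \<le> g'" and a: "a + 1 \<le> a' \<or> a' + 1 \<le> a"
  shows "(\<exists>x. - D - 2 * g \<le> x \<and> x \<le> e \<and> - D - 2 * g' \<le> x \<and> x \<le> e' \<and> line g a e x = line g' a' e' x)
    \<longleftrightarrow> a' < a"
proof -
  let ?x0 = "- D - 2 * g"
  have x0: "line g a e ?x0 = g"
    unfolding line_def slope_def using b D_ge by (simp add: field_simps)
  have x0': "g < line g' a' e' ?x0"
    using line_far[OF b(7-11) b(3,4)] g unfolding abs_le_iff by linarith
  have near: "\<bar>line g a e x - a\<bar> \<le> 1 / 8" "\<bar>line g' a' e' x - a'\<bar> \<le> 1 / 8" if "0 \<le> x" "x \<le> N" for x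
    using line_near b that by auto
  show ?thesis
  proof
    assume "\<exists>x. ?x0 \<le> x \<and> x \<le> e \<and> - D - 2 * g' \<le> x \<and> x \<le> e' \<and> line g a e x = line g' a' e' x"
    then obtain x where x: "?x0 \<le> x" "x \<le> e" "line g a e x = line g' a' e' x" by blast
    show "a' < a"
    proof (rule ccontr)
      assume "\<not> a' < a"
      then have "a + 1 \<le> a'" using a by linarith
      define A where "A = a' - slope g' a' e' * e' - (a - slope g a e * e)"
      define B where "B = slope g' a' e' - slope g a e"
      have AB: "A + B * x = line g' a' e' x - line g a e x" for x
        unfolding A_def B_def line_def by (simp add: algebra_simps)
      have "0 < A + B * ?x0" unfolding AB using x0 x0' by simp
      moreover have "0 < A + B * N"
        unfolding AB using near[of N] N \<open>a + 1 \<le> a'\<close> unfolding abs_le_iff by linarith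
      ultimately have "0 < A + B * x" using affine_pos x b(6) by (meson order_trans)
      then show False unfolding AB using x(3) by simp
    qed
  next
    assume "a' < a"
    then have "a' + 1 \<le> a" using a by linarith
    have "\<exists>x. ?x0 \<le> x \<and> x \<le> 0 \<and> line g a e x - line g' a' e' x = 0"
    proof (rule IVT')
      show "line g a e ?x0 - line g' a' e' ?x0 \<le> 0" using x0 x0' by simp
      show "0 \<le> line g a e 0 - line g' a' e' 0"
        using near[of 0] N \<open>a' + 1 \<le> a\<close> unfolding abs_le_iff by linarith
      show "?x0 \<le> 0" using b D_ge by simp
    qed (intro continuous_intros)
    then obtain x where x: "?x0 \<le> x" "x \<le> 0" "line g a e x = line g' a' e' x" by auto
    then show "\<exists>x. ?x0 \<le> x \<and> x \<le> e \<and> - D - 2 * g' \<le> x \<and> x \<le> e' \<and> line g a e x = line g' a' e' x"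
      using b g by (intro exI[of _ x]) auto
  qed
qed

text \<open>The horizontal segment stays at heights in \<open>[0, N]\<close>, where the vertical one
  is within 1/8 of abscissa \<open>a'\<close>; so they can meet only if the former reaches beyond
  \<open>a'\<close>. In that case the intermediate value theorem along the vertical line, for height
  minus height of the horizontal line, gives a crossing.\<close>

lemma cross_meet:
  assumes b: "0 \<le> a" "a \<le> N" "0 \<le> g" "g \<le> N" "0 \<le> e" "e \<le> N"
      "0 \<le> a'" "a' \<le> N" "0 \<le> g'" "g' \<le> N"
    and e: "e + 1 \<le> a' \<or> a' + 1 \<le> e"
  shows "(\<exists>x y. - D - 2 * g \<le> x \<and> x \<le> e \<and> y = line g a e x \<and>
      - D - 2 * g' \<le> y \<and> y \<le> N \<and> x = line g' a' N y) \<longleftrightarrow> a' < e"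
proof
  assume "\<exists>x y. - D - 2 * g \<le> x \<and> x \<le> e \<and> y = line g a e x \<and>
      - D - 2 * g' \<le> y \<and> y \<le> N \<and> x = line g' a' N y"
  then obtain x y where xy: "- D - 2 * g \<le> x" "x \<le> e" "y = line g a e x" "x = line g' a' N y" by blast
  have "0 \<le> y" "y \<le> N" using line_range[OF b(1-5) xy(1,2)] xy(3) by auto
  then have "\<bar>x - a'\<bar> \<le> 1 / 8" using line_near[OF b(7-10), of N y] N xy(4) by simp
  then show "a' < e" using xy(2) e unfolding abs_le_iff by linarith
next
  assume "a' < e"
  then have e: "a' + 1 \<le> e" using e by linarith
  let ?h = "line g' a' N"
  have h: "- D - 2 * g \<le> ?h y" "?h y \<le> e" if "0 \<le> y" "y \<le> N" for y
  proof -
    have "\<bar>?h y - a'\<bar> \<le> 1 / 8" using line_near[OF b(7-10), of N y] N that by simp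
    then show "- D - 2 * g \<le> ?h y" "?h y \<le> e"
      using e b(3,7) D_ge unfolding abs_le_iff by linarith+
  qed
  have "\<exists>y. 0 \<le> y \<and> y \<le> N \<and> y - line g a e (?h y) = 0"
  proof (rule IVT')
    show "0 - line g a e (?h 0) \<le> 0" using line_range(1)[OF b(1-5)] h[of 0] N by simp
    show "0 \<le> N - line g a e (?h N)" using line_range(2)[OF b(1-5)] h[of N] N by simp
  qed (use N in \<open>auto intro!: continuous_intros\<close>)
  then obtain y where y: "0 \<le> y" "y \<le> N" "y = line g a e (?h y)" by auto
  then show "\<exists>x y. - D - 2 * g \<le> x \<and> x \<le> e \<and> y = line g a e x \<and>
      - D - 2 * g' \<le> y \<and> y \<le> N \<and> x = line g' a' N y"
    using h[OF y(1,2)] b D_ge by (intro exI[of _ "?h y"] exI[of _ y]) auto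
qed

end

section \<open>Chains\<close>

context frame
begin

text \<open>The points \<open>Q v\<close> and \<open>R v\<close> lie on the two sides of a fixed cone, which contains the middle
  segments; the outer segments run on the other side of its boundary lines and enter the square
  \<open>[0, N] \<times> [0, N]\<close> almost horizontally, respectively almost vertically.\<close>

definition P where "P v = pt (lo v) (al v)"
definition Q where "Q v = pt (- D - 2 * real (ga v)) (ga v)"
definition R where "R v = pt (lo v) (- D - 2 * real (lo v))"
definition T where "T v = pt (hi v) N"

definition chain where
  "chain v = closed_segment (P v) (Q v) \<union> closed_segment (Q v) (R v) \<union> closed_segment (R v) (T v)"

definition small where "small v \<longleftrightarrow> al v \<le> N \<and> ga v \<le> N \<and> lo v \<le> N \<and> hi v \<le> N"

section \<open>The three segments relative to the cone\<close>

lemma in_PQ: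
  "z \<in> closed_segment (P v) (Q v) \<longleftrightarrow>
    - D - 2 * real (ga v) \<le> z $ 1 \<and> z $ 1 \<le> lo v \<and> z $ 2 = line (ga v) (al v) (lo v) (z $ 1)"
proof -
  have "- D - 2 * real (ga v) < lo v" using D_ge by simp
  from segment_graph[OF this, of "z $ 1" "z $ 2" "ga v" "al v"] show ?thesis
    unfolding closed_segment_commute[of "P v" "Q v"] unfolding P_def Q_def in_segment_pt line_def slope_def
    by (auto simp: add.assoc)
qed

lemma in_RT:
  "z \<in> closed_segment (R v) (T v) \<longleftrightarrow>
    - D - 2 * real (lo v) \<le> z $ 2 \<and> z $ 2 \<le> N \<and> z $ 1 = line (lo v) (hi v) N (z $ 2)"
proof -
  have "- D - 2 * real (lo v) < N" using D_ge N by simp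
  from segment_graph[OF this, of "z $ 2" "z $ 1" "lo v" "hi v"] show ?thesis
    unfolding R_def T_def in_segment_pt line_def slope_def by (auto simp: add.assoc)
qed

text \<open>The two linear forms are coordinates on the cone. The factor 2 in \<open>Q\<close> and
  \<open>R\<close> makes the first vanish at \<open>Q v\<close> and the second at
  \<open>R v\<close>, so the segment runs from \<open>(0, D + 3 * ga v)\<close> to
  \<open>(D + 3 * lo v, 0)\<close>.\<close>

lemma in_QR:
  "z \<in> closed_segment (Q v) (R v) \<longleftrightarrow> (\<exists>u :: real. 0 \<le> u \<and> u \<le> 1 \<and>
     - (z $ 1 + 2 * z $ 2 + D) = u * (D + 3 * real (lo v)) \<and> - (2 * z $ 1 + z $ 2 + D) = (1 - u) * (D + 3 * real (ga v)))"
proof -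
  have "z $ 1 = (1 - u) * (- D - 2 * real (ga v)) + u * lo v \<and> z $ 2 = (1 - u) * ga v + u * (- D - 2 * real (lo v)) \<longleftrightarrow>
      - (z $ 1 + 2 * z $ 2 + D) = u * (D + 3 * real (lo v)) \<and> - (2 * z $ 1 + z $ 2 + D) = (1 - u) * (D + 3 * real (ga v))" for u
  proof -
    let ?x = "(1 - u) * (- D - 2 * real (ga v)) + u * lo v" and ?y = "(1 - u) * ga v + u * (- D - 2 * real (lo v))"
    have eq: "?x + 2 * ?y + D = - (u * (D + 3 * real (lo v)))" "2 * ?x + ?y + D = - ((1 - u) * (D + 3 * real (ga v)))"
      by (simp_all add: algebra_simps)
    have lin: "z $ 1 = x \<and> z $ 2 = y \<longleftrightarrow> - (z $ 1 + 2 * z $ 2 + D) = p \<and> - (2 * z $ 1 + z $ 2 + D) = q"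
      if "x + 2 * y + D = - p" "2 * x + y + D = - q" for x y p q
      by (rule iffI; elim conjE; rule conjI) (use that in linarith)+
    show ?thesis by (rule lin[OF eq])
  qed
  then show ?thesis unfolding Q_def R_def in_segment_pt by simp
qed

text \<open>The form is affine, zero at \<open>Q v\<close> and positive at
  \<open>P v\<close>.\<close>

lemma PQ_side:
  assumes "z \<in> closed_segment (P v) (Q v)" "z \<noteq> Q v"
  shows "0 < z $ 1 + 2 * z $ 2 + D"
proof -
  obtain u :: real where u: "0 \<le> u" "u \<le> 1" "z $ 1 = (1 - u) * lo v + u * (- D - 2 * real (ga v))"
    "z $ 2 = (1 - u) * al v + u * ga v"
    using assms(1) unfolding P_def Q_def in_segment_pt by blast
  have "u \<noteq> 1" using u assms(2) unfolding Q_def pt_eq_iff by auto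
  have "z $ 1 + 2 * z $ 2 + D = (1 - u) * (lo v + 2 * real (al v) + D)"
    unfolding u by (simp add: algebra_simps)
  then show ?thesis using u(2) \<open>u \<noteq> 1\<close> D_ge by simp
qed

lemma RT_side:
  assumes "z \<in> closed_segment (R v) (T v)" "z \<noteq> R v"
  shows "0 < 2 * z $ 1 + z $ 2 + D"
proof -
  obtain u :: real where u: "0 \<le> u" "u \<le> 1" "z $ 1 = (1 - u) * lo v + u * hi v"
    "z $ 2 = (1 - u) * (- D - 2 * real (lo v)) + u * N"
    using assms(1) unfolding R_def T_def in_segment_pt by blast
  have "u \<noteq> 0" using u assms(2) unfolding R_def pt_eq_iff by auto
  have "2 * z $ 1 + z $ 2 + D = u * (2 * real (hi v) + N + D)"
    unfolding u by (simp add: algebra_simps)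
  then show ?thesis using u(1) \<open>u \<noteq> 0\<close> D_ge N by simp
qed

lemma QR_side:
  assumes "z \<in> closed_segment (Q v) (R v)"
  shows "z $ 1 + 2 * z $ 2 + D \<le> 0" "2 * z $ 1 + z $ 2 + D \<le> 0"
proof -
  obtain u :: real where u: "0 \<le> u" "u \<le> 1" "- (z $ 1 + 2 * z $ 2 + D) = u * (D + 3 * real (lo v))"
    "- (2 * z $ 1 + z $ 2 + D) = (1 - u) * (D + 3 * real (ga v))"
    using assms in_QR by blast
  have "0 \<le> u * (D + 3 * real (lo v))" "0 \<le> (1 - u) * (D + 3 * real (ga v))" using u(1,2) D_ge by simp_all
  then show "z $ 1 + 2 * z $ 2 + D \<le> 0" "2 * z $ 1 + z $ 2 + D \<le> 0" using u(3,4) by linarith+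
qed

lemma Q_in_QR:
  assumes "Q v \<in> closed_segment (Q w) (R w)"
  shows "ga v = ga w"
proof -
  obtain u :: real where u: "- (Q v $ 1 + 2 * Q v $ 2 + D) = u * (D + 3 * real (lo w))"
    "- (2 * Q v $ 1 + Q v $ 2 + D) = (1 - u) * (D + 3 * real (ga w))"
    using assms unfolding in_QR by blast
  have "D + 3 * real (lo w) \<noteq> 0" using D_ge by simp
  then have "u = 0" using u(1) by (simp add: Q_def)
  then show ?thesis using u(2) by (simp add: Q_def)
qed

lemma R_in_QR:
  assumes "R v \<in> closed_segment (Q w) (R w)"
  shows "lo v = lo w"
proof -
  obtain u :: real where u: "- (R v $ 1 + 2 * R v $ 2 + D) = u * (D + 3 * real (lo w))"
    "- (2 * R v $ 1 + R v $ 2 + D) = (1 - u) * (D + 3 * real (ga w))"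
    using assms unfolding in_QR by blast
  have "D + 3 * real (ga w) \<noteq> 0" using D_ge by simp
  then have "u = 1" using u(2) by (simp add: R_def)
  then show ?thesis using u(1) by (simp add: R_def)
qed

lemma PQ_Int_QR:
  "z \<in> closed_segment (P v) (Q v) \<Longrightarrow> z \<in> closed_segment (Q w) (R w) \<Longrightarrow> z = Q v \<and> ga v = ga w"
  using PQ_side[of z v] QR_side(1)[of z w] Q_in_QR[of v w] by (cases "z = Q v") auto

lemma RT_Int_QR:
  "z \<in> closed_segment (R v) (T v) \<Longrightarrow> z \<in> closed_segment (Q w) (R w) \<Longrightarrow> z = R v \<and> lo v = lo w"
  using RT_side[of z v] QR_side(2)[of z w] R_in_QR[of v w] by (cases "z = R v") auto

section \<open>Crossings of segments and the disjointness criterion\<close>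

lemma real_nat_gap: "m \<noteq> n \<Longrightarrow> real m + 1 \<le> real n \<or> real n + 1 \<le> real m"
  by linarith

lemma PQ_meets_RT:
  assumes "small v" "small w" "lo v \<noteq> hi w"
  shows "closed_segment (P v) (Q v) \<inter> closed_segment (R w) (T w) \<noteq> {} \<longleftrightarrow> hi w < lo v"
proof -
  have "closed_segment (P v) (Q v) \<inter> closed_segment (R w) (T w) \<noteq> {} \<longleftrightarrow>
    (\<exists>x y :: real. - D - 2 * real (ga v) \<le> x \<and> x \<le> lo v \<and> y = line (ga v) (al v) (lo v) x \<and>
      - D - 2 * real (lo w) \<le> y \<and> y \<le> N \<and> x = line (lo w) (hi w) N y)" (is "_ \<longleftrightarrow> ?ex")
  proof
    assume "closed_segment (P v) (Q v) \<inter> closed_segment (R w) (T w) \<noteq> {}"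
    then obtain z where "z \<in> closed_segment (P v) (Q v)" "z \<in> closed_segment (R w) (T w)" by blast
    then show ?ex unfolding in_PQ in_RT by blast
  next
    assume ?ex
    then obtain x y :: real where "- D - 2 * real (ga v) \<le> x \<and> x \<le> lo v \<and> y = line (ga v) (al v) (lo v) x"
      "- D - 2 * real (lo w) \<le> y \<and> y \<le> N \<and> x = line (lo w) (hi w) N y" by blast
    then have "pt x y \<in> closed_segment (P v) (Q v)" "pt x y \<in> closed_segment (R w) (T w)"
      unfolding in_PQ in_RT by simp_all
    then show "closed_segment (P v) (Q v) \<inter> closed_segment (R w) (T w) \<noteq> {}" by blast
  qed
  also have "\<dots> \<longleftrightarrow> real (hi w) < real (lo v)"
    using assms real_nat_gap[OF assms(3)] by (intro cross_meet) (auto simp: small_def)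
  finally show ?thesis by simp
qed

lemma PQ_meets_PQ:
  assumes "small v" "small w" "ga v < ga w" "al v \<noteq> al w"
  shows "closed_segment (P v) (Q v) \<inter> closed_segment (P w) (Q w) \<noteq> {} \<longleftrightarrow> al w < al v"
proof -
  have "closed_segment (P v) (Q v) \<inter> closed_segment (P w) (Q w) \<noteq> {} \<longleftrightarrow>
    (\<exists>x :: real. - D - 2 * real (ga v) \<le> x \<and> x \<le> lo v \<and> - D - 2 * real (ga w) \<le> x \<and> x \<le> lo w \<and>
      line (ga v) (al v) (lo v) x = line (ga w) (al w) (lo w) x)" (is "_ \<longleftrightarrow> ?ex")
  proof
    assume "closed_segment (P v) (Q v) \<inter> closed_segment (P w) (Q w) \<noteq> {}"
    then obtain z where "z \<in> closed_segment (P v) (Q v)" "z \<in> closed_segment (P w) (Q w)" by blast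
    then show ?ex unfolding in_PQ by metis
  next
    assume ?ex
    then obtain x :: real where "- D - 2 * real (ga v) \<le> x \<and> x \<le> lo v \<and> - D - 2 * real (ga w) \<le> x \<and> x \<le> lo w \<and>
      line (ga v) (al v) (lo v) x = line (ga w) (al w) (lo w) x" by blast
    then have "pt x (line (ga v) (al v) (lo v) x) \<in> closed_segment (P v) (Q v) \<inter> closed_segment (P w) (Q w)"
      unfolding Int_iff in_PQ by simp
    then show "closed_segment (P v) (Q v) \<inter> closed_segment (P w) (Q w) \<noteq> {}" by blast
  qed
  also have "\<dots> \<longleftrightarrow> real (al w) < real (al v)"
    using assms real_nat_gap[OF assms(4)] by (intro lines_meet) (auto simp: small_def)
  finally show ?thesis by simp
qed

lemma RT_meets_RT:
  assumes "small v" "small w" "lo v < lo w" "hi v \<noteq> hi w"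
  shows "closed_segment (R v) (T v) \<inter> closed_segment (R w) (T w) \<noteq> {} \<longleftrightarrow> hi w < hi v"
proof -
  have "closed_segment (R v) (T v) \<inter> closed_segment (R w) (T w) \<noteq> {} \<longleftrightarrow>
    (\<exists>x :: real. - D - 2 * real (lo v) \<le> x \<and> x \<le> N \<and> - D - 2 * real (lo w) \<le> x \<and> x \<le> N \<and>
      line (lo v) (hi v) N x = line (lo w) (hi w) N x)" (is "_ \<longleftrightarrow> ?ex")
  proof
    assume "closed_segment (R v) (T v) \<inter> closed_segment (R w) (T w) \<noteq> {}"
    then obtain z where "z \<in> closed_segment (R v) (T v)" "z \<in> closed_segment (R w) (T w)" by blast
    then show ?ex unfolding in_RT by metis
  next
    assume ?ex
    then obtain x :: real where "- D - 2 * real (lo v) \<le> x \<and> x \<le> N \<and> - D - 2 * real (lo w) \<le> x \<and> x \<le> N \<and>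
      line (lo v) (hi v) N x = line (lo w) (hi w) N x" by blast
    then have "pt (line (lo v) (hi v) N x) x \<in> closed_segment (R v) (T v) \<inter> closed_segment (R w) (T w)"
      unfolding Int_iff in_RT by simp
    then show "closed_segment (R v) (T v) \<inter> closed_segment (R w) (T w) \<noteq> {}" by blast
  qed
  also have "\<dots> \<longleftrightarrow> real (hi w) < real (hi v)"
    using assms real_nat_gap[OF assms(4)] N by (intro lines_meet) (auto simp: small_def)
  finally show ?thesis by simp
qed

lemma QR_meets_QR:
  assumes "lo v \<noteq> lo w" "ga v \<noteq> ga w"
  shows "closed_segment (Q v) (R v) \<inter> closed_segment (Q w) (R w) \<noteq> {} \<longleftrightarrow> (lo v < lo w \<longleftrightarrow> ga w < ga v)"
proof -
  have "closed_segment (Q v) (R v) \<inter> closed_segment (Q w) (R w) \<noteq> {} \<longleftrightarrow>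
    (\<exists>u u' :: real. 0 \<le> u \<and> u \<le> 1 \<and> 0 \<le> u' \<and> u' \<le> 1 \<and> u * (D + 3 * real (lo v)) = u' * (D + 3 * real (lo w)) \<and>
      (1 - u) * (D + 3 * real (ga v)) = (1 - u') * (D + 3 * real (ga w)))" (is "_ \<longleftrightarrow> ?ex")
  proof
    assume "closed_segment (Q v) (R v) \<inter> closed_segment (Q w) (R w) \<noteq> {}"
    then obtain z where "z \<in> closed_segment (Q v) (R v)" "z \<in> closed_segment (Q w) (R w)" by blast
    then show ?ex unfolding in_QR by metis
  next
    assume ?ex
    then obtain u u' :: real where u: "0 \<le> u" "u \<le> 1" "0 \<le> u'" "u' \<le> 1"
      "u * (D + 3 * real (lo v)) = u' * (D + 3 * real (lo w))" "(1 - u) * (D + 3 * real (ga v)) = (1 - u') * (D + 3 * real (ga w))" by blast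
    define X where "X = u * (D + 3 * real (lo v))"
    define Y where "Y = (1 - u) * (D + 3 * real (ga v))"
    \<comment> \<open>The point with cone coordinates \<open>X\<close> and \<open>Y\<close>, by
      inverting the two linear forms.\<close>
    define z where "z = pt ((X - 2 * Y - D) / 3) ((Y - 2 * X - D) / 3)"
    have z: "- (z $ 1 + 2 * z $ 2 + D) = X" "- (2 * z $ 1 + z $ 2 + D) = Y"
      unfolding z_def by (simp_all add: field_simps)
    have "z \<in> closed_segment (Q v) (R v)"
      unfolding in_QR z using u(1,2) X_def Y_def by blast
    moreover have "z \<in> closed_segment (Q w) (R w)"
      unfolding in_QR z using u X_def Y_def by blast
    ultimately show "closed_segment (Q v) (R v) \<inter> closed_segment (Q w) (R w) \<noteq> {}" by blast
  qed
  also have "\<dots> \<longleftrightarrow> (D + 3 * real (lo v) < D + 3 * real (lo w) \<longleftrightarrow> D + 3 * real (ga w) < D + 3 * real (ga v))"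
    using assms D_ge by (intro cone_segments_meet) (simp_all add: add_pos_nonneg)
  finally show ?thesis by simp
qed

text \<open>Of the nine pairs of segments, the four pairing an outer with a middle one are separated
  by the cone. Four of the other five give the clauses of \<open>below\<close>, oriented by
  \<open>ga v < ga w\<close>; the fifth, \<open>lo v < hi w\<close>, follows from
  \<open>lo v < lo w\<close>.\<close>

lemma chain_Int_aux:
  assumes b: "small v" "small w"
    and ne: "al v \<noteq> al w" "lo v \<noteq> lo w" "hi v \<noteq> hi w" "lo v \<noteq> hi w" "lo w \<noteq> hi v"
    and lh: "lo v < hi v" "lo w < hi w"
    and ga: "ga v < ga w"
  shows "chain v \<inter> chain w = {} \<longleftrightarrow> below v w"
proof -
  have ga': "ga v \<noteq> ga w" "ga w \<noteq> ga v" using ga by auto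
  have no: "closed_segment (P v) (Q v) \<inter> closed_segment (Q w) (R w) = {}"
      "closed_segment (Q v) (R v) \<inter> closed_segment (P w) (Q w) = {}"
      "closed_segment (R v) (T v) \<inter> closed_segment (Q w) (R w) = {}"
      "closed_segment (Q v) (R v) \<inter> closed_segment (R w) (T w) = {}"
    using PQ_Int_QR ga' RT_Int_QR ne(2) by (metis disjoint_iff)+
  have *: "chain v \<inter> chain w = {} \<longleftrightarrow>
      closed_segment (P v) (Q v) \<inter> closed_segment (P w) (Q w) = {} \<and>
      closed_segment (Q v) (R v) \<inter> closed_segment (Q w) (R w) = {} \<and>
      closed_segment (R v) (T v) \<inter> closed_segment (R w) (T w) = {} \<and>
      closed_segment (P v) (Q v) \<inter> closed_segment (R w) (T w) = {} \<and>
      closed_segment (P w) (Q w) \<inter> closed_segment (R v) (T v) = {}"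
    unfolding chain_def Int_Un_distrib Int_Un_distrib2 Un_empty no
    by (simp add: Int_commute conj_ac)
  show ?thesis
  proof (cases "lo v < lo w")
    case True
    then show ?thesis
      unfolding * below_def
      using PQ_meets_PQ[OF b ga ne(1)] QR_meets_QR[OF ne(2) ga'(1)] RT_meets_RT[OF b True ne(3)]
        PQ_meets_RT[OF b ne(4)] PQ_meets_RT[OF b(2,1) ne(5)] ga ne lh
      by auto
  next
    case False
    then have "closed_segment (Q v) (R v) \<inter> closed_segment (Q w) (R w) \<noteq> {}"
      using QR_meets_QR[OF ne(2) ga'(1)] ga by simp
    then show ?thesis unfolding * below_def using False by simp
  qed
qed

lemma chain_Int:
  assumes "generic F" "\<And>v. v \<in> F \<Longrightarrow> small v" "v \<in> F" "w \<in> F" "v \<noteq> w"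
  shows "chain v \<inter> chain w = {} \<longleftrightarrow> below v w \<or> below w v"
proof -
  have g: "al v \<noteq> al w" "ga v \<noteq> ga w" "lo v \<noteq> lo w" "hi v \<noteq> hi w" "lo v \<noteq> hi w" "lo w \<noteq> hi v"
    "lo v < hi v" "lo w < hi w"
    using assms(1,3-5) unfolding generic_def inj_on_def by blast+
  note b = assms(2)[OF assms(3)] assms(2)[OF assms(4)]
  show ?thesis
  proof (cases "ga v < ga w")
    case True
    then show ?thesis using chain_Int_aux[OF b] g by (auto simp: below_def)
  next
    case False
    then have "ga w < ga v" using g(2) by simp
    then show ?thesis using chain_Int_aux[OF b(2,1)] g False
      by (simp add: Int_commute) (auto simp: below_def)
  qed
qed

lemma path_image_chain: "path_image (chain3_path (P v) (Q v) (R v) (T v)) = chain v"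
  unfolding chain3_path_def chain_def by (simp add: path_image_join Un_assoc)

lemma simple_chain:
  assumes "small v" "lo v < hi v"
  shows "simple_3chain (chain v)"
proof -
  have neq: "P v \<noteq> Q v" "Q v \<noteq> R v" "R v \<noteq> T v"
    unfolding P_def Q_def R_def T_def pt_eq_iff using D_ge N by auto
  have QRT: "arc (linepath (Q v) (R v) +++ linepath (R v) (T v))"
    using neq RT_Int_QR[of _ v v] by (intro arc_join arc_linepath) auto
  have "closed_segment (P v) (Q v) \<inter> closed_segment (R v) (T v) = {}"
    using PQ_meets_RT[OF assms(1,1)] assms(2) by auto
  then have "path_image (linepath (P v) (Q v)) \<inter>
      path_image (linepath (Q v) (R v) +++ linepath (R v) (T v)) \<subseteq> {Q v}"
    using PQ_Int_QR[of _ v v] by (auto simp: path_image_join)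
  then have "arc (chain3_path (P v) (Q v) (R v) (T v))"
    unfolding chain3_path_def by (intro arc_join[OF arc_linepath[OF neq(1)] QRT]) auto
  then show ?thesis unfolding simple_3chain_def using path_image_chain by metis
qed

end

lemma chain_representation:
  assumes "finite F" "generic F"
  shows "\<exists>chain. (\<forall>v\<in>F. simple_3chain (chain v)) \<and>
    (\<forall>v\<in>F. \<forall>w\<in>F. v \<noteq> w \<longrightarrow> (chain v \<inter> chain w = {} \<longleftrightarrow> below v w \<or> below w v))"
proof -
  let ?M = "al ` F \<union> ga ` F \<union> lo ` F \<union> hi ` F"
  have "finite ?M" using assms(1) by simp
  then obtain m where m: "\<And>n. n \<in> ?M \<Longrightarrow> n < m"
    unfolding finite_nat_set_iff_bounded by (elim exE) (rule that, rule bspec)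
  interpret frame "real (Suc m)" by unfold_locales simp
  have b: "small v" if "v \<in> F" for v
  proof -
    have "al v < m" "ga v < m" "lo v < m" "hi v < m" using m that by blast+
    then show ?thesis unfolding small_def by simp
  qed
  have "simple_3chain (chain v)" if "v \<in> F" for v
    using simple_chain[OF b[OF that]] assms(2) that unfolding generic_def by blast
  then show ?thesis using chain_Int[OF assms(2) b] by blast
qed

section \<open>Girth and chromatic number\<close>

text \<open>The edges of a cycle form a family without a leaf: each shares both ends with its
  neighbours, which differ from it because the length is at least 3. Such a family has more than
  \<open>g\<close> members.\<close>

lemma sparse_imp_girth_ge:
  assumes sp: "sparse g (edges F)"
    and adj: "\<And>A B. A \<in> X \<Longrightarrow> B \<in> X \<Longrightarrow> E A B \<Longrightarrow> {r A, r B} \<in> edges F"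
    and inj: "inj_on r X"
  shows "enat g \<le> girth X E"
  unfolding girth_def
proof (rule INF_greatest)
  fix vs assume "vs \<in> {vs. is_cycle X E vs}"
  then have vs: "3 \<le> length vs" "distinct vs" "set vs \<subseteq> X"
    "\<And>i. i < length vs \<Longrightarrow> E (vs ! i) (vs ! ((i + 1) mod length vs))"
    unfolding is_cycle_def by auto
  let ?n = "length vs"
  define x where "x i = r (vs ! (i mod ?n))" for i
  have n: "0 < ?n" using vs(1) by linarith
  have mem: "vs ! (i mod ?n) \<in> X" for i using vs(3) n by (meson mod_less_divisor nth_mem subsetD)
  have x_eq: "x i = x j \<longleftrightarrow> i mod ?n = j mod ?n" for i j
    unfolding x_def using inj_on_eq_iff[OF inj mem mem] nth_eq_iff_index_eq[OF vs(2)] n by simp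
  define e where "e i = {x i, x (Suc i)}" for i
  define C where "C = e ` {..<?n}"
  have e_mod: "e (i mod ?n) = e i" for i
    unfolding e_def x_def by (simp add: mod_Suc_eq)
  have e_C: "e i \<in> C" for i
    unfolding C_def using e_mod[of i] n by (metis imageI lessThan_iff mod_less_divisor)
  have "C \<subseteq> edges F"
  proof
    fix d assume "d \<in> C"
    then obtain i where i: "i < ?n" "d = e i" unfolding C_def by blast
    have "E (vs ! (i mod ?n)) (vs ! (Suc i mod ?n))" using vs(4)[OF i(1)] i(1) by simp
    then show "d \<in> edges F" unfolding i(2) e_def x_def using adj mem by blast
  qed
  moreover have "C \<noteq> {}" "finite C" unfolding C_def using n by auto
  ultimately have leaf: "\<exists>d\<in>C. \<exists>y. d \<inter> \<Union>(C - {d}) \<subseteq> {y}" if "card C \<le> g"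
    using sp that unfolding sparse_def by blast
  have "x i \<noteq> x (i + d)" if "0 < d" "d < 3" for i d
  proof
    assume "x i = x (i + d)"
    then have "?n dvd i + d - i" unfolding x_eq using mod_eq_dvd_iff_nat[of i "i + d" ?n] by simp
    then show False using dvd_imp_le[of ?n d] that vs(1) by simp
  qed
  from this[of 1] this[of 2] have far: "x i \<noteq> x (i + 1)" "x i \<noteq> x (i + 2)" for i by simp_all
  have "\<not> d \<inter> \<Union>(C - {d}) \<subseteq> {y}" if d: "d \<in> C" for d y
  proof
    assume y: "d \<inter> \<Union>(C - {d}) \<subseteq> {y}"
    obtain i where i: "i < ?n" "d = e i" using d unfolding C_def by blast
    \<comment> \<open>The cyclic predecessor of \<open>i\<close>, shifted by one period so that
      \<open>i = 0\<close> causes no truncated subtraction.\<close>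
    define j where "j = i + ?n - 1"
    have j: "Suc j mod ?n = i mod ?n" unfolding j_def using n by simp
    then have xj: "x (Suc j) = x i" "x (Suc (Suc j)) = x (Suc i)"
      unfolding x_eq by (simp, metis mod_Suc_eq)
    have "e j \<noteq> d" "e (Suc i) \<noteq> d"
      unfolding i(2) e_def using far[of j] far[of i] far[of "Suc i"] far[of "Suc j"] xj
      by (auto simp: doubleton_eq_iff numeral_2_eq_2)
    then have "e j \<in> C - {d}" "e (Suc i) \<in> C - {d}" using e_C by blast+
    moreover have "x i \<in> e j" "x (Suc i) \<in> e (Suc i)" "x i \<in> d" "x (Suc i) \<in> d"
      unfolding e_def i(2) using xj by auto
    ultimately have "x i \<in> d \<inter> \<Union>(C - {d})" "x (Suc i) \<in> d \<inter> \<Union>(C - {d})" by blast+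
    then have "x i = x (Suc i)" using y by auto
    then show False using far(1)[of i] by simp
  qed
  then have "g < card C" using leaf by (meson not_le)
  also have "card C \<le> ?n" unfolding C_def using card_image_le[of "{..<?n}" e] by simp
  finally show "enat g \<le> enat ?n" by simp
qed

theorem theorem3:
  fixes g k :: int
  shows "\<exists>F :: (real^2) set set. finite F \<and> (\<forall>C\<in>F. simple_3chain C) \<and>
           girth F (disj_adj F) \<ge> enat (nat g) \<and>
           int (chromatic_number F (disj_adj F)) \<ge> k"
proof -
  obtain V where V: "finite V" "V \<noteq> {}" "generic V" "sparse (Suc (nat g)) (edges V)"
    "uncolourable (nat k) V"
    using uncolourable_sparse by blast
  obtain chain where chain: "\<forall>v\<in>V. simple_3chain (chain v)"
    "\<forall>v\<in>V. \<forall>w\<in>V. v \<noteq> w \<longrightarrow> (chain v \<inter> chain w = {} \<longleftrightarrow> below v w \<or> below w v)"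
    using chain_representation[OF V(1,3)] by (elim exE conjE)
  define F where "F = chain ` V"
  have "finite F" unfolding F_def using V(1) by simp
  moreover have "\<forall>C\<in>F. simple_3chain C" unfolding F_def using chain(1) by blast
  moreover have "enat (nat g) \<le> girth F (disj_adj F)"
  proof -
    \<comment> \<open>One vertex is chosen for each chain; this choice is injective on
      \<open>F\<close> by itself.\<close>
    let ?r = "inv_into V chain"
    have r: "?r A \<in> V" "chain (?r A) = A" if "A \<in> F" for A
      using inv_into_into[of A chain V] f_inv_into_f[of A chain V] that unfolding F_def by blast+
    have "enat (Suc (nat g)) \<le> girth F (disj_adj F)"
    proof (rule sparse_imp_girth_ge[OF V(4)])
      show "inj_on ?r F" unfolding F_def by (rule inj_on_inv_into) simp
      show "{?r A, ?r B} \<in> edges V" if "A \<in> F" "B \<in> F" "disj_adj F A B" for A B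
      proof -
        have "?r A \<noteq> ?r B" using r[OF that(1)] r[OF that(2)] that(3) unfolding disj_adj_def by metis
        moreover have "chain (?r A) \<inter> chain (?r B) = {}"
          using r[OF that(1)] r[OF that(2)] that(3) unfolding disj_adj_def by simp
        ultimately have "below (?r A) (?r B) \<or> below (?r B) (?r A)"
          using chain(2) r(1)[OF that(1)] r(1)[OF that(2)] by blast
        then show ?thesis
          using r(1)[OF that(1)] r(1)[OF that(2)] unfolding edges_def by (auto simp: insert_commute)
      qed
    qed
    then show ?thesis by (rule order_trans[rotated]) simp
  qed
  moreover have "k \<le> int (chromatic_number F (disj_adj F))"
  proof -
    let ?ok = "\<lambda>n. \<exists>c :: (real^2) set \<Rightarrow> nat. (\<forall>v\<in>F. c v < n) \<and>
       (\<forall>u\<in>F. \<forall>v\<in>F. disj_adj F u v \<longrightarrow> c u \<noteq> c v)"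
    \<comment> \<open>An injective colouring shows that the \<open>LEAST\<close> in the chromatic
      number is attained.\<close>
    obtain h where h: "bij_betw h F {0..<card F}"
      using ex_bij_betw_finite_nat[OF \<open>finite F\<close>] by blast
    have "h u \<noteq> h v" if "u \<in> F" "v \<in> F" "disj_adj F u v" for u v
      using that bij_betw_imp_inj_on[OF h] unfolding disj_adj_def inj_on_def by blast
    moreover have "h v < card F" if "v \<in> F" for v using bij_betwE[OF h] that by auto
    ultimately have "?ok (card F)" by blast
    then have "?ok (chromatic_number F (disj_adj F))"
      unfolding chromatic_number_def by (rule LeastI[of ?ok])
    then obtain c where c: "\<forall>v\<in>F. c v < chromatic_number F (disj_adj F)"
      "\<forall>u\<in>F. \<forall>v\<in>F. disj_adj F u v \<longrightarrow> c u \<noteq> c v" by blast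
    have "\<not> chromatic_number F (disj_adj F) \<le> nat k"
    proof
      assume le: "chromatic_number F (disj_adj F) \<le> nat k"
      have "(c \<circ> chain) ` V \<subseteq> {..<nat k}" using c(1) le unfolding F_def by force
      then obtain v w where vw: "v \<in> V" "w \<in> V" "below v w" "c (chain v) = c (chain w)"
        using V(5)[unfolded uncolourable_def, rule_format, of "{..<nat k}" "c \<circ> chain"] by auto
      have "v \<noteq> w" using vw(3) unfolding below_def by auto
      then have "chain v \<inter> chain w = {}" using chain(2) vw by blast
      \<comment> \<open>Adjacency asks for distinct sets, and disjoint sets are distinct once one of
        them is nonempty.\<close>
      moreover have "chain v \<noteq> {}"
        using chain(1) vw(1) unfolding simple_3chain_def by fastforce
      ultimately have "disj_adj F (chain v) (chain w)"
        unfolding disj_adj_def F_def using vw(1,2) by blast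
      then show False using c(2) vw unfolding F_def by blast
    qed
    then show ?thesis by linarith
  qed
  ultimately show ?thesis by blast
qed

end
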